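(* Let $\kappa$ be a regular uncountable cardinal and let $U$ be a $\sigma$-complete ultrafilter over $\kappa$ which is Dodd sound and is not a $p$-point. Then $U$ is non-Galvin.
   Context: $j_U:V\to M_U$ is the ultrapower embedding into the transitive collapse of the ultrapower, and $[f]_U$ is the element of $M_U$ represented by $f$. $U$ is Dodd sound if the function $P(\kappa)\to M_U$, $X\mapsto j_U(X)\cap[\mathrm{id}]_U$, belongs to $M_U$. A function $f:\kappa\to\kappa$ is unbounded mod $U$ if $f^{-1}[\alpha]\notin U$ for all $\alpha<\kappa$; it is almost one-to-one mod $U$ if there is $A\in U$ such that $\{\alpha\in A\mid f(\alpha)=x\}$ is bounded in $\kappa$ for every $x$. $U$ is a $p$-point if every $f:\kappa\to\kappa$ that is unbounded mod $U$ is almost one-to-one mod $U$. A uniform ultrafilter $U$ over $\kappa$ has the Galvin property if for every sequence $\langle A_i\rangle_{i<2^\kappa}$ of members of $U$ there is $I\subseteq2^\kappa$ with $|I|=\kappa$ and $\bigcap_{i\in I}A_i\in U$; $U$ is non-Galvin if it does not have the Galvin property. *)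

theory Defs
  imports Main "HOL-Library.Equipollence" "HOL-Library.Countable_Set" "HOL-Library.FuncSet"
begin

(* The universe V is rendered as a type whose membership relation (x is a member of y iff
   x \<in> elts y) satisfies the ZF axioms. Separation and replacement are stated for arbitrary HOL
   predicates and functions, as in Paulson's ZFC_in_HOL; choice is inherited from HOL.
   Consequently a HOL subset of "elts x", or a HOL function on "elts x", is the same thing as
   an element of the universe, and subsets of kappa, functions on kappa and families of subsets
   of kappa are written below as HOL sets and functions whenever they need not themselves be
   elements of something. *)
class zfc_universe =
  fixes elts :: "'a \<Rightarrow> 'a set"
  assumes extensionality: "elts x = elts y \<Longrightarrow> x = y"
    and foundation: "wf {(x, y). x \<in> elts y}"
    and separation: "\<exists>z. elts z = {y \<in> elts x. P y}"
    and pairing: "\<exists>z. elts z = {x, y}"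
    and union: "\<exists>z. elts z = (\<Union>y\<in>elts x. elts y)"
    and power_set: "\<exists>z. elts z = {y. elts y \<subseteq> elts x}"
    and replacement: "\<exists>z. elts z = f ` elts x"
    and infinity: "\<exists>z. (\<exists>e\<in>elts z. elts e = {}) \<and>
                       (\<forall>x\<in>elts z. \<exists>y\<in>elts z. elts y = insert x (elts x))"

(* Only meaningful if S is set-sized, i.e. S \<in> range elts. *)
definition vset :: "'v::zfc_universe set \<Rightarrow> 'v" where
  "vset S = (THE x. elts x = S)"

definition vpair :: "'v::zfc_universe \<Rightarrow> 'v \<Rightarrow> 'v" where
  "vpair x y = vset {vset {x}, vset {x, y}}"

definition vpow :: "'v::zfc_universe \<Rightarrow> 'v" where
  "vpow x = vset {y. elts y \<subseteq> elts x}"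


(* Von Neumann ordinals and cardinals; for ordinals, "\<alpha> < \<beta>" is "\<alpha> \<in> elts \<beta>". *)

definition transitive_set :: "'v::zfc_universe \<Rightarrow> bool" where
  "transitive_set x \<longleftrightarrow> (\<forall>y\<in>elts x. elts y \<subseteq> elts x)"

definition ordinal :: "'v::zfc_universe \<Rightarrow> bool" where
  "ordinal \<alpha> \<longleftrightarrow> transitive_set \<alpha> \<and> (\<forall>\<beta>\<in>elts \<alpha>. transitive_set \<beta>)"

definition cardinal :: "'v::zfc_universe \<Rightarrow> bool" where
  "cardinal \<kappa> \<longleftrightarrow> ordinal \<kappa> \<and> (\<forall>\<alpha>\<in>elts \<kappa>. \<not> elts \<alpha> \<approx> elts \<kappa>)"

definition cardinality :: "'v::zfc_universe \<Rightarrow> 'v" where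
  "cardinality x = (THE \<mu>. cardinal \<mu> \<and> elts \<mu> \<approx> elts x)"

definition two_to_the :: "'v::zfc_universe \<Rightarrow> 'v" where
  "two_to_the \<kappa> = cardinality (vpow \<kappa>)"

definition bounded_in :: "'v::zfc_universe \<Rightarrow> 'v set \<Rightarrow> bool" where
  "bounded_in \<kappa> S \<longleftrightarrow> (\<exists>\<alpha>\<in>elts \<kappa>. S \<subseteq> elts \<alpha>)"

definition regular_cardinal :: "'v::zfc_universe \<Rightarrow> bool" where
  "regular_cardinal \<kappa> \<longleftrightarrow> cardinal \<kappa> \<and> infinite (elts \<kappa>) \<and>
     (\<forall>S. S \<subseteq> elts \<kappa> \<and> S \<prec> elts \<kappa> \<longrightarrow> bounded_in \<kappa> S)"


definition ultrafilter_over :: "'a set \<Rightarrow> 'a set set \<Rightarrow> bool" where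
  "ultrafilter_over K U \<longleftrightarrow> U \<subseteq> Pow K \<and> K \<in> U \<and> {} \<notin> U \<and>
     (\<forall>A B. A \<in> U \<and> A \<subseteq> B \<and> B \<subseteq> K \<longrightarrow> B \<in> U) \<and>
     (\<forall>A B. A \<in> U \<and> B \<in> U \<longrightarrow> A \<inter> B \<in> U) \<and>
     (\<forall>A. A \<subseteq> K \<longrightarrow> A \<in> U \<or> K - A \<in> U)"

definition sigma_complete :: "'a set set \<Rightarrow> bool" where
  "sigma_complete U \<longleftrightarrow> (\<forall>A :: nat \<Rightarrow> 'a set. (\<forall>n. A n \<in> U) \<longrightarrow> (\<Inter>n. A n) \<in> U)"


(* The ultrapower of the universe by U. A function from kappa to V is a HOL function, of which
   only the values on "elts \<kappa>" matter. *)

definition ult_mem :: "'v::zfc_universe \<Rightarrow> 'v set set \<Rightarrow> ('v \<Rightarrow> 'v) \<Rightarrow> ('v \<Rightarrow> 'v) \<Rightarrow> bool" where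
  "ult_mem \<kappa> U g f \<longleftrightarrow> {\<alpha> \<in> elts \<kappa>. g \<alpha> \<in> elts (f \<alpha>)} \<in> U"

(* "ult_class \<kappa> U f" is [f]_U: the transitive collapse of the ultrapower, precomposed with the
   quotient map. It is determined by the recursion [f]_U = {[g]_U | g is a U-member of f},
   which has exactly one solution when U is a sigma-complete ultrafilter, since then ult_mem is
   well-founded and set-like modulo U. Functions that agree on a set in U have the
   same U-members, hence the same value. *)
definition ult_class :: "'v::zfc_universe \<Rightarrow> 'v set set \<Rightarrow> ('v \<Rightarrow> 'v) \<Rightarrow> 'v" where
  "ult_class \<kappa> U = (THE \<pi>. \<forall>f. elts (\<pi> f) = {\<pi> g | g. ult_mem \<kappa> U g f})"

definition ult_model :: "'v::zfc_universe \<Rightarrow> 'v set set \<Rightarrow> 'v set" where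
  "ult_model \<kappa> U = range (ult_class \<kappa> U)"

definition ult_emb :: "'v::zfc_universe \<Rightarrow> 'v set set \<Rightarrow> 'v \<Rightarrow> 'v" where
  "ult_emb \<kappa> U x = ult_class \<kappa> U (\<lambda>_. x)"

definition dodd_sound :: "'v::zfc_universe \<Rightarrow> 'v set set \<Rightarrow> bool" where
  "dodd_sound \<kappa> U \<longleftrightarrow>
     vset {vpair X (vset (elts (ult_emb \<kappa> U X) \<inter> elts (ult_class \<kappa> U (\<lambda>\<alpha>. \<alpha>)))) | X.
             X \<in> elts (vpow \<kappa>)} \<in> ult_model \<kappa> U"


definition unbounded_mod :: "'v::zfc_universe \<Rightarrow> 'v set set \<Rightarrow> ('v \<Rightarrow> 'v) \<Rightarrow> bool" where
  "unbounded_mod \<kappa> U f \<longleftrightarrow> (\<forall>\<alpha>\<in>elts \<kappa>. {\<beta> \<in> elts \<kappa>. f \<beta> \<in> elts \<alpha>} \<notin> U)"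

definition almost_one_to_one_mod :: "'v::zfc_universe \<Rightarrow> 'v set set \<Rightarrow> ('v \<Rightarrow> 'v) \<Rightarrow> bool" where
  "almost_one_to_one_mod \<kappa> U f \<longleftrightarrow> (\<exists>A\<in>U. \<forall>x. bounded_in \<kappa> {\<alpha> \<in> A. f \<alpha> = x})"

definition p_point :: "'v::zfc_universe \<Rightarrow> 'v set set \<Rightarrow> bool" where
  "p_point \<kappa> U \<longleftrightarrow>
     (\<forall>f \<in> elts \<kappa> \<rightarrow> elts \<kappa>. unbounded_mod \<kappa> U f \<longrightarrow> almost_one_to_one_mod \<kappa> U f)"

definition galvin_property :: "'v::zfc_universe \<Rightarrow> 'v set set \<Rightarrow> bool" where
  "galvin_property \<kappa> U \<longleftrightarrow>
     (\<forall>A :: 'v \<Rightarrow> 'v set. (\<forall>i\<in>elts (two_to_the \<kappa>). A i \<in> U) \<longrightarrow>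
        (\<exists>I. I \<subseteq> elts (two_to_the \<kappa>) \<and> I \<approx> elts \<kappa> \<and> (\<Inter>i\<in>I. A i) \<in> U))"

end

theory Submission
  imports Defs
begin

text \<open>
  Let \<open>j\<close> be the ultrapower embedding. By Dodd soundness the family \<open>{j(X) \<inter> [id] | X \<subseteq> \<kappa>}\<close> is represented
  by some \<open>\<alpha> \<mapsto> \<A> \<alpha>\<close> with \<open>\<A> \<alpha> \<subseteq> P(\<alpha>)\<close>: every \<open>X \<subseteq> \<kappa>\<close> satisfies \<open>X \<inter> \<alpha> \<in> \<A> \<alpha>\<close> almost everywhere, and every
  selection from \<open>\<A>\<close> has the form \<open>\<alpha> \<mapsto> X \<inter> \<alpha>\<close>. The sets \<open>A\<^sub>X = {\<alpha> | X \<inter> \<alpha> \<in> \<A> \<alpha>}\<close> witness the failure of the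
  Galvin property. To see this, let \<open>f\<close> be unbounded but not almost one-to-one. It suffices to bound
  \<open>|\<A> \<alpha>|\<close> strictly by some \<open>\<theta>(f(\<alpha>)) < \<kappa>\<close>: if \<open>\<kappa>\<close> many \<open>A\<^sub>X\<close> contained a common set in \<open>U\<close>, an unbounded
  fibre of \<open>f\<close> in it would contain an \<open>\<alpha>\<close> at which \<open>\<theta>(f(\<alpha>))\<close> many of the \<open>X\<close> are already distinguished.

  Since \<open>{j(\<xi>) | \<xi> < \<kappa>}\<close> is represented by \<open>B \<alpha> = {\<nu> < \<alpha> | {\<nu>} \<in> \<A> \<alpha>}\<close> and \<open>Y \<mapsto> Y \<inter> B \<alpha>\<close> is injective on \<open>\<A> \<alpha>\<close>,
  one has \<open>|\<A> \<alpha>| \<le> 2\<^bsup>|B \<alpha>|\<^esup>\<close>, and \<open>B \<alpha> \<subseteq> f(\<alpha>)\<close>. This gives the bound if \<open>\<kappa>\<close> is a strong limit. Otherwise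
  let \<open>D\<close> be the largest strong limit below \<open>\<kappa>\<close>. An instance of Kunen's inconsistency argument shows
  \<open>|B \<alpha> \<inter> D| < D\<close>, and this propagates to \<open>|B \<alpha>| < D\<close> because there are no strong limits in \<open>(D, \<kappa>]\<close>.
\<close>

section \<open>Cardinalities\<close>

unbundle cardinal_syntax

lemma not_lepoll_iff_lesspoll: "\<not> A \<lesssim> B \<longleftrightarrow> B \<prec> A"
  using ordLeq_total[OF card_of_Well_order[of A] card_of_Well_order[of B]]
  unfolding lesspoll_def card_of_ordLeq[symmetric]
  by (metis lepoll_def card_of_ordLeq eqpoll_imp_lepoll eqpoll_sym lepoll_antisym)

lemma lesspoll_cases: "A \<prec> B \<or> B \<lesssim> A"
  using not_lepoll_iff_lesspoll by blast

lemma Pow_lepoll_mono: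
  assumes "A \<lesssim> B" shows "Pow A \<lesssim> Pow B"
proof -
  obtain f where f: "inj_on f A" "f ` A \<subseteq> B" using assms by (auto simp: lepoll_def)
  then have "inj_on (image f) (Pow A)" by (simp add: inj_on_image_Pow)
  moreover have "image f ` Pow A \<subseteq> Pow B" using f by auto
  ultimately show ?thesis by (auto simp: lepoll_def)
qed

text \<open>Transfinite recursion along a well-order of \<open>P\<close> of least possible type:
  fewer than |P| values have been used before \<open>p\<close>, so they cannot exhaust
  \<open>T p\<close>.\<close>

lemma inj_selector_exists:
  fixes T :: "'p \<Rightarrow> 'a set"
  assumes "\<And>p. p \<in> P \<Longrightarrow> P \<lesssim> T p"
  shows "\<exists>s. inj_on s P \<and> (\<forall>p\<in>P. s p \<in> T p)"
proof -
  define R where "R = |P| - Id"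
  have wo: "well_order_on P |P|" by (rule card_of_well_order_on)
  have wfR: "wf R" using wo by (simp add: R_def well_order_on_def)
  define s where "s = wfrec R (\<lambda>s p. SOME x. x \<in> T p \<and> x \<notin> s ` {q. (q, p) \<in> R})"
  have s: "s p = (SOME x. x \<in> T p \<and> x \<notin> s ` {q. (q, p) \<in> R})" for p
  proof -
    have "s p = (SOME x. x \<in> T p \<and> x \<notin> cut s R p ` {q. (q, p) \<in> R})"
      unfolding s_def by (subst wfrec[OF wfR]) simp
    moreover have "cut s R p ` {q. (q, p) \<in> R} = s ` {q. (q, p) \<in> R}"
      by (auto simp: cut_def image_iff)
    ultimately show ?thesis by simp
  qed
  have s_mem: "s p \<in> T p \<and> s p \<notin> s ` {q. (q, p) \<in> R}" if "p \<in> P" for p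
  proof -
    have "{q. (q, p) \<in> R} = underS |P| p" by (auto simp: R_def underS_def)
    moreover have "|underS |P| p| <o |P|"
      using that by (intro card_of_underS card_of_Card_order) (simp add: Field_card_of)
    ultimately have "|{q. (q, p) \<in> R}| <o |P|" by simp
    then have "\<not> P \<lesssim> {q. (q, p) \<in> R}"
      unfolding lepoll_def card_of_ordLeq by (rule not_ordLess_ordLeq)
    then have "\<not> T p \<lesssim> s ` {q. (q, p) \<in> R}"
      using assms[OF that] by (metis image_lepoll lepoll_trans)
    then have "\<exists>x. x \<in> T p \<and> x \<notin> s ` {q. (q, p) \<in> R}"
      using subset_imp_lepoll[of "T p" "s ` {q. (q, p) \<in> R}"] by blast
    then have "(SOME x. x \<in> T p \<and> x \<notin> s ` {q. (q, p) \<in> R}) \<in> T p \<and>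
        (SOME x. x \<in> T p \<and> x \<notin> s ` {q. (q, p) \<in> R}) \<notin> s ` {q. (q, p) \<in> R}"
      by (rule someI_ex)
    then show ?thesis unfolding s[of p, symmetric] .
  qed
  have "inj_on s P"
  proof (rule inj_onI, rule ccontr)
    fix p q assume pq: "p \<in> P" "q \<in> P" "s p = s q" "p \<noteq> q"
    then have "(p, q) \<in> R \<or> (q, p) \<in> R"
      using wo by (auto simp: R_def well_order_on_def linear_order_on_def total_on_def)
    then have "s p \<in> s ` {r. (r, q) \<in> R} \<or> s q \<in> s ` {r. (r, p) \<in> R}" by blast
    then show False using s_mem[of p] s_mem[of q] pq by simp
  qed
  then show ?thesis using s_mem by blast
qed

lemma infinite_Pow_Times_lepoll:
  assumes "infinite L" shows "Pow L \<times> L \<lesssim> Pow L"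
proof -
  have "infinite (Pow L)" using assms by simp
  then have "|Pow L \<times> Pow L| =o |Pow L|" by (rule card_of_Times_same_infinite)
  then have "Pow L \<times> Pow L \<approx> Pow L" by (simp add: eqpoll_iff_card_of_ordIso)
  moreover have "Pow L \<times> L \<lesssim> Pow L \<times> Pow L"
    by (intro times_lepoll_mono lepoll_refl lepoll_Pow_self)
  ultimately show ?thesis using lepoll_trans2 by blast
qed

text \<open>This is the Erdos-Hajnal construction of an \<open>\<omega>\<close>-Jonsson function: pairs \<open>(S, y)\<close> are served by
  distinct sequences, which exist since the hypotheses on \<open>S\<close> give at least \<open>|Pow L|\<close> sequences in \<open>S\<close>.\<close>

lemma jonsson_function_exists:
  fixes C :: "nat \<Rightarrow> 'a set"
  assumes inf: "infinite (\<Union>n. C n)"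
  shows "\<exists>J :: (nat \<Rightarrow> 'a) \<Rightarrow> 'a. \<forall>S y. S \<subseteq> (\<Union>n. C n) \<and> (\<forall>n. Pow (C n) \<lesssim> S) \<and> y \<in> (\<Union>n. C n)
    \<longrightarrow> (\<exists>s. range s \<subseteq> S \<and> J s = y)"
proof -
  define L where "L = (\<Union>n. C n)"
  define P where "P = {(S, y). S \<subseteq> L \<and> (\<forall>n. Pow (C n) \<lesssim> S) \<and> y \<in> L}"
  define T :: "'a set \<times> 'a \<Rightarrow> (nat \<Rightarrow> 'a) set" where "T = (\<lambda>p. {s. range s \<subseteq> fst p})"
  have "P \<lesssim> T p" if "p \<in> P" for p
  proof -
    obtain S y where p: "p = (S, y)" by (cases p)
    have "\<forall>n. \<exists>c. inj_on c (Pow (C n)) \<and> c ` Pow (C n) \<subseteq> S"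
      using that by (auto simp: P_def p lepoll_def)
    then obtain c where c: "\<And>n. inj_on (c n) (Pow (C n))" "\<And>n. c n ` Pow (C n) \<subseteq> S" by metis
    \<comment> \<open>A subset of \<open>L\<close> is recovered from its traces on the sets
      \<open>C n\<close>, and \<open>c n\<close> codes the trace on \<open>C n\<close> by a point of
      \<open>S\<close>.\<close>
    have "inj_on (\<lambda>Z n. c n (Z \<inter> C n)) (Pow L)"
    proof (rule inj_onI)
      fix Y Z assume YZ: "Y \<in> Pow L" "Z \<in> Pow L" and "(\<lambda>n. c n (Y \<inter> C n)) = (\<lambda>n. c n (Z \<inter> C n))"
      then have "c n (Y \<inter> C n) = c n (Z \<inter> C n)" for n by meson
      then have "Y \<inter> C n = Z \<inter> C n" for n by (rule inj_onD[OF c(1)]) auto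
      then have "Y \<inter> L = Z \<inter> L" unfolding L_def by blast
      then show "Y = Z" using YZ by blast
    qed
    moreover have "(\<lambda>Z n. c n (Z \<inter> C n)) ` Pow L \<subseteq> T p" using c(2) by (fastforce simp: T_def p)
    ultimately have "Pow L \<lesssim> T p" by (auto simp: lepoll_def)
    moreover have "P \<lesssim> Pow L \<times> L" by (rule subset_imp_lepoll) (auto simp: P_def)
    moreover have "Pow L \<times> L \<lesssim> Pow L" using inf by (intro infinite_Pow_Times_lepoll) (simp add: L_def)
    ultimately show ?thesis using lepoll_trans by metis
  qed
  then obtain s where s: "inj_on s P" "\<forall>p\<in>P. s p \<in> T p" using inj_selector_exists[of P T] by blast
  have "\<exists>t. range t \<subseteq> S \<and> snd (inv_into P s t) = y" if "(S, y) \<in> P" for S y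
  proof -
    have "s (S, y) \<in> T (S, y)" using s(2) that by blast
    then have "range (s (S, y)) \<subseteq> S" by (simp add: T_def)
    moreover have "snd (inv_into P s (s (S, y))) = y" using s(1) that by simp
    ultimately show ?thesis by blast
  qed
  \<comment> \<open>\<open>J\<close> sends a sequence to the second component of the pair it serves;
    its values at other sequences are irrelevant.\<close>
  then show ?thesis by (intro exI[of _ "\<lambda>t. snd (inv_into P s t)"]) (auto simp: P_def L_def)
qed

section \<open>Sets and ordinals of the universe\<close>

definition small :: "'v::zfc_universe set \<Rightarrow> bool" where
  "small S \<longleftrightarrow> S \<in> range elts"

lemma elts_vset: "small S \<Longrightarrow> elts (vset S) = S"
  unfolding small_def vset_def
  by (rule theI'[of "\<lambda>x. elts x = S"]) (auto intro: extensionality)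

lemma vset_elts [simp]: "vset (elts x) = x"
  unfolding vset_def by (rule the_equality) (auto intro: extensionality)

lemma small_elts [simp]: "small (elts x)"
  by (simp add: small_def)

lemma small_subset:
  assumes "small S" "T \<subseteq> S" shows "small T"
proof -
  obtain x where "S = elts x" using assms by (auto simp: small_def)
  moreover from this obtain z where "elts z = {y \<in> elts x. y \<in> T}"
    using separation[of x "\<lambda>y. y \<in> T"] by blast
  ultimately have "elts z = T" using assms(2) by blast
  then show ?thesis by (metis small_def rangeI)
qed

lemma small_image:
  fixes f :: "'v::zfc_universe \<Rightarrow> 'v"
  assumes "small S" shows "small (f ` S)"
proof -
  obtain x where "S = elts x" using assms by (auto simp: small_def)
  moreover obtain z where "elts z = f ` elts x" using replacement[of f x] by blast
  ultimately show ?thesis by (metis small_def rangeI)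
qed

lemma small_doubleton: "small {x, y}"
  unfolding small_def using pairing by (metis rangeI)

lemma small_UN:
  fixes f :: "'v::zfc_universe \<Rightarrow> 'v set"
  assumes "small S" "\<And>a. a \<in> S \<Longrightarrow> small (f a)" shows "small (\<Union>a\<in>S. f a)"
proof -
  have "small ((\<lambda>a. vset (f a)) ` S)" by (rule small_image[OF assms(1)])
  then obtain z where z: "elts z = (\<lambda>a. vset (f a)) ` S" by (auto simp: small_def)
  have "(\<Union>a\<in>S. f a) = (\<Union>y\<in>elts z. elts y)" using assms(2) by (auto simp: z elts_vset)
  then show ?thesis using union[of z] unfolding small_def by (metis rangeI)
qed

lemma elts_vpow: "elts (vpow x) = {y. elts y \<subseteq> elts x}"
  unfolding vpow_def using power_set[of x] by (intro elts_vset) (metis small_def rangeI)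

lemma vset_Pow_elts: "X \<subseteq> elts x \<Longrightarrow> elts (vset X) = X"
  using elts_vset small_subset small_elts by blast

lemma elts_vpair: "elts (vpair x y) = {vset {x}, vset {x, y}}"
  unfolding vpair_def by (rule elts_vset[OF small_doubleton])

lemma vset_pair_eq_iff: "vset {a, b} = vset {c, d} \<longleftrightarrow> {a, b} = {c, d}"
  by (metis elts_vset small_doubleton)

lemma vpair_inject [simp]: "vpair a b = vpair c d \<longleftrightarrow> a = c \<and> b = d"
proof
  assume "vpair a b = vpair c d"
  \<comment> \<open>Singletons are written as doubletons so that one rule for equality of doubletons
    applies at both levels.\<close>
  then have "{vset {a, a}, vset {a, b}} = {vset {c, c}, vset {c, d}}"
    by (metis elts_vpair insert_absorb2)
  then show "a = c \<and> b = d"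
    by (simp only: doubleton_eq_iff vset_pair_eq_iff) auto
qed simp

lemma vpow_eqpoll: "elts (vpow x) \<approx> Pow (elts x)"
proof -
  have "bij_betw elts (elts (vpow x)) (Pow (elts x))"
    by (rule bij_betw_byWitness[where f' = vset]) (auto simp: elts_vpow vset_Pow_elts)
  then show ?thesis by (auto simp: eqpoll_def)
qed

lemma elts_differ:
  assumes "x \<noteq> y" shows "\<exists>z. z \<in> elts x - elts y \<or> z \<in> elts y - elts x"
proof (rule ccontr)
  assume "\<not> ?thesis"
  then have "elts x = elts y" by blast
  then show False using assms extensionality by blast
qed

section \<open>Foundation, von Neumann ordinals and cardinals\<close>

lemma mem_irrefl: "x \<notin> elts x"
  using foundation wf_not_refl by fastforce

lemma mem_asym: "x \<in> elts y \<Longrightarrow> y \<notin> elts x"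
  using foundation wf_not_sym by fastforce

lemma mem_induct [case_names step]:
  assumes "\<And>x. (\<And>y. y \<in> elts x \<Longrightarrow> P y) \<Longrightarrow> P x" shows "P x"
  using foundation by (rule wf_induct_rule) (use assms in blast)

lemma mem_min:
  assumes "P x" shows "\<exists>z. P z \<and> (\<forall>y\<in>elts z. \<not> P y)"
  using assms by (induction x rule: mem_induct) blast

lemma ordinal_mem: "ordinal a \<Longrightarrow> x \<in> elts a \<Longrightarrow> ordinal x"
  unfolding ordinal_def transitive_set_def by blast

lemma ordinal_trans: "ordinal a \<Longrightarrow> y \<in> elts a \<Longrightarrow> x \<in> elts y \<Longrightarrow> x \<in> elts a"
  unfolding ordinal_def transitive_set_def by blast

text \<open>Nested membership induction on both ordinals. If neither inclusion fails, extensionality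
  applies; otherwise an element of one outside the other is compared by the induction
  hypothesis.\<close>

lemma ordinal_linear: "ordinal a \<Longrightarrow> ordinal b \<Longrightarrow> a \<in> elts b \<or> a = b \<or> b \<in> elts a"
proof (induction a arbitrary: b rule: mem_induct)
  case (step a)
  note IHa = this
  show ?case using step.prems(2)
  proof (induction b rule: mem_induct)
    case (step b)
    show ?case
    proof (cases "elts a \<subseteq> elts b")
      case True
      show ?thesis
      proof (cases "elts b \<subseteq> elts a")
        case True
        then have "a = b" using \<open>elts a \<subseteq> elts b\<close> by (intro extensionality) auto
        then show ?thesis by blast
      next
        case False
        then obtain y where y: "y \<in> elts b" "y \<notin> elts a" by blast
        then have "a \<in> elts y \<or> a = y" using step.IH[OF y(1)] ordinal_mem[OF step.prems y(1)] by blast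
        then show ?thesis using y(1) ordinal_trans[OF step.prems y(1)] by blast
      qed
    next
      case False
      then obtain x where x: "x \<in> elts a" "x \<notin> elts b" by blast
      then have "x = b \<or> b \<in> elts x"
        using IHa(1)[OF x(1) ordinal_mem[OF IHa(2) x(1)] step.prems] by blast
      then show ?thesis using x(1) ordinal_trans[OF IHa(2) x(1)] by blast
    qed
  qed
qed

lemma ordinal_subset_iff: "ordinal a \<Longrightarrow> ordinal b \<Longrightarrow> elts a \<subseteq> elts b \<longleftrightarrow> b \<notin> elts a"
  using ordinal_linear[of a b] ordinal_trans[of b a] mem_irrefl by blast

text \<open>Reflexive, because the library's theory of well-orders uses reflexive relations.\<close>

definition ord_rel :: "'v::zfc_universe set \<Rightarrow> ('v \<times> 'v) set" where
  "ord_rel S = {(x, y). x \<in> S \<and> y \<in> S \<and> (x = y \<or> x \<in> elts y)}"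

lemma well_order_on_ord_rel:
  assumes "\<And>x. x \<in> S \<Longrightarrow> ordinal x" shows "well_order_on S (ord_rel S)"
proof -
  have "wf (ord_rel S - Id)"
    by (rule wf_subset[OF foundation]) (auto simp: ord_rel_def)
  moreover have "trans (ord_rel S)"
    using assms ordinal_trans by (fastforce simp: trans_def ord_rel_def)
  moreover have "antisym (ord_rel S)"
    using mem_asym by (fastforce simp: antisym_def ord_rel_def)
  ultimately show ?thesis
    using assms ordinal_linear
    unfolding well_order_on_def linear_order_on_def partial_order_on_def preorder_on_def
    by (fastforce simp: refl_on_def total_on_def ord_rel_def)
qed

text \<open>The cardinal order of \<open>S\<close> is at most any well-order of \<open>S\<close>, so
  \<open>A\<close> with its cardinal order embeds as a proper initial segment of \<open>S\<close>
  ordered by membership.\<close>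

lemma lesspoll_initial_segment:
  assumes S: "\<And>x. x \<in> S \<Longrightarrow> ordinal x" and A: "A \<prec> S"
  shows "\<exists>a\<in>S. A \<approx> S \<inter> elts a"
proof -
  have wo: "well_order_on S (ord_rel S)" using S by (rule well_order_on_ord_rel)
  have F: "Field (ord_rel S) = S" by (auto simp: ord_rel_def Field_def)
  have WO: "Well_order (ord_rel S)" using wo F by simp
  have "|A| <o |S|"
    using A not_lepoll_iff_lesspoll[of S A] card_of_ordLess[of S A] by (auto simp: lepoll_def)
  then have "|A| <o ord_rel S" using card_of_least[OF wo] ordLess_ordLeq_trans by blast
  then obtain a where a: "a \<in> S" "|A| =o Restr (ord_rel S) (underS (ord_rel S) a)"
    using ordLess_iff_ordIso_Restr[OF WO card_of_Well_order] F by auto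
  have U: "underS (ord_rel S) a = S \<inter> elts a"
    using a(1) mem_irrefl by (auto simp: underS_def ord_rel_def)
  have "Field (Restr (ord_rel S) (underS (ord_rel S) a)) = S \<inter> elts a"
    unfolding U by (auto simp: Field_def ord_rel_def)
  moreover obtain f where "iso |A| (Restr (ord_rel S) (underS (ord_rel S) a)) f"
    using a(2) by (auto simp: ordIso_def)
  ultimately have "bij_betw f A (S \<inter> elts a)" by (simp add: iso_def Field_card_of)
  then show ?thesis using a(1) by (auto simp: eqpoll_def)
qed

text \<open>The Mostowski collapse \<open>\<phi>\<close> of a well-order of \<open>elts x\<close>
  has an ordinal as its range.\<close>

lemma ordinal_eqpoll_exists: "\<exists>a::'v. ordinal a \<and> elts a \<approx> elts (x::'v::zfc_universe)"
proof -
  define R where "R = |elts x| - Id"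
  have wo: "well_order_on (elts x) |elts x|" by (rule card_of_well_order_on)
  have wfR: "wf R" using wo by (simp add: R_def well_order_on_def)
  have trR: "trans R"
    using wo by (auto simp: R_def well_order_on_def linear_order_on_def partial_order_on_def
        preorder_on_def intro: trans_diff_Id)
  have Rx: "(p, q) \<in> R \<Longrightarrow> p \<in> elts x \<and> q \<in> elts x" for p q
    using wo unfolding R_def well_order_on_def linear_order_on_def partial_order_on_def
      preorder_on_def refl_on_def by blast
  define \<phi> :: "'v \<Rightarrow> 'v" where "\<phi> = wfrec R (\<lambda>\<phi> p. vset (\<phi> ` {q. (q, p) \<in> R}))"
  have \<phi>: "\<phi> p = vset (\<phi> ` {q. (q, p) \<in> R})" for p
  proof -
    have "\<phi> p = vset (cut \<phi> R p ` {q. (q, p) \<in> R})"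
      unfolding \<phi>_def by (subst wfrec[OF wfR]) simp
    moreover have "cut \<phi> R p ` {q. (q, p) \<in> R} = \<phi> ` {q. (q, p) \<in> R}"
      by (auto simp: cut_def image_iff)
    ultimately show ?thesis by simp
  qed
  have elts_\<phi>: "elts (\<phi> p) = \<phi> ` {q. (q, p) \<in> R}" for p
    by (subst \<phi>, rule elts_vset, rule small_image, rule small_subset[OF small_elts[of x]])
      (use Rx in blast)
  have tr: "transitive_set (\<phi> p)" for p
    using trR by (fastforce simp: transitive_set_def elts_\<phi> trans_def)
  define a where "a = vset (\<phi> ` elts x)"
  have a: "elts a = \<phi> ` elts x" unfolding a_def by (rule elts_vset) (simp add: small_image)
  have "ordinal a" using tr Rx by (fastforce simp: ordinal_def transitive_set_def a elts_\<phi>)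
  moreover have "inj_on \<phi> (elts x)"
  proof (rule inj_onI, rule ccontr)
    fix p q assume pq: "p \<in> elts x" "q \<in> elts x" "\<phi> p = \<phi> q" "p \<noteq> q"
    then have "(p, q) \<in> R \<or> (q, p) \<in> R"
      using wo by (auto simp: R_def well_order_on_def linear_order_on_def total_on_def)
    then have "\<phi> p \<in> elts (\<phi> q) \<or> \<phi> q \<in> elts (\<phi> p)" by (auto simp: elts_\<phi>)
    then show False using pq mem_irrefl by metis
  qed
  then have "elts a \<approx> elts x" unfolding a by (rule inj_on_image_eqpoll_self)
  ultimately show ?thesis by blast
qed

text \<open>The least ordinal equipotent to \<open>x\<close> is the only such cardinal, so the
  definite description in \<open>cardinality\<close> denotes it.\<close>

lemma cardinality_eqpoll: "elts (cardinality x) \<approx> elts (x::'v::zfc_universe)"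
proof -
  obtain b :: 'v where b: "ordinal b" "elts b \<approx> elts x" using ordinal_eqpoll_exists by blast
  obtain a :: 'v where a: "ordinal a" "elts a \<approx> elts x"
    and min: "\<forall>y\<in>elts a. \<not> (ordinal y \<and> elts y \<approx> elts x)"
    using mem_min[of "\<lambda>a. ordinal a \<and> elts a \<approx> elts x", OF conjI[OF b]] by blast
  have "cardinal a" unfolding cardinal_def
    using a min by (metis ordinal_mem eqpoll_trans)
  moreover have "c = a" if "cardinal c" "elts c \<approx> elts x" for c :: 'v
  proof -
    have "elts c \<approx> elts a" "elts a \<approx> elts c" using that a by (metis eqpoll_trans eqpoll_sym)+
    then show ?thesis
      using that(1) \<open>cardinal a\<close> ordinal_linear[of c a] unfolding cardinal_def by blast
  qed
  ultimately have "cardinality x = a" unfolding cardinality_def using a(2) by (intro the_equality) blast+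
  then show ?thesis using a by simp
qed

lemma two_to_the_eqpoll: "elts (two_to_the x) \<approx> Pow (elts x)"
  unfolding two_to_the_def using cardinality_eqpoll vpow_eqpoll by (rule eqpoll_trans)

section \<open>Ultrapowers\<close>

locale sigma_ultrafilter =
  fixes \<kappa> :: "'v::zfc_universe" and U :: "'v set set"
  assumes ultrafilter: "ultrafilter_over (elts \<kappa>) U" and sigma: "sigma_complete U"
begin

text \<open>\<open>U\<close> as a HOL filter on the whole type, concentrating on
  \<open>elts \<kappa>\<close>, so that almost-everywhere arguments can use
  \<open>eventually_elim\<close>.\<close>

definition ae :: "'v filter" where
  "ae = Abs_filter (\<lambda>P. {\<alpha> \<in> elts \<kappa>. P \<alpha>} \<in> U)"

lemma eventually_ae: "eventually P ae \<longleftrightarrow> {\<alpha> \<in> elts \<kappa>. P \<alpha>} \<in> U"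
  unfolding ae_def
proof (rule eventually_Abs_filter, rule is_filter.intro)
  show "{\<alpha> \<in> elts \<kappa>. True} \<in> U" using ultrafilter by (simp add: ultrafilter_over_def)
next
  fix P Q assume "{\<alpha> \<in> elts \<kappa>. P \<alpha>} \<in> U" "{\<alpha> \<in> elts \<kappa>. Q \<alpha>} \<in> U"
  then have "{\<alpha> \<in> elts \<kappa>. P \<alpha>} \<inter> {\<alpha> \<in> elts \<kappa>. Q \<alpha>} \<in> U"
    using ultrafilter unfolding ultrafilter_over_def by blast
  moreover have "{\<alpha> \<in> elts \<kappa>. P \<alpha>} \<inter> {\<alpha> \<in> elts \<kappa>. Q \<alpha>} = {\<alpha> \<in> elts \<kappa>. P \<alpha> \<and> Q \<alpha>}"
    by blast
  ultimately show "{\<alpha> \<in> elts \<kappa>. P \<alpha> \<and> Q \<alpha>} \<in> U" by simp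
next
  fix P Q assume "\<forall>x. P x \<longrightarrow> Q x" "{\<alpha> \<in> elts \<kappa>. P \<alpha>} \<in> U"
  moreover have "\<And>A B. A \<in> U \<Longrightarrow> A \<subseteq> B \<Longrightarrow> B \<subseteq> elts \<kappa> \<Longrightarrow> B \<in> U"
    using ultrafilter unfolding ultrafilter_over_def by blast
  ultimately show "{\<alpha> \<in> elts \<kappa>. Q \<alpha>} \<in> U"
    by (metis (no_types, lifting) Collect_mono mem_Collect_eq subsetI)
qed

lemma eventually_ae_in: "eventually (\<lambda>\<alpha>. \<alpha> \<in> elts \<kappa>) ae"
  using ultrafilter by (simp add: eventually_ae ultrafilter_over_def)

lemma eventually_ae_not: "eventually (\<lambda>\<alpha>. \<not> P \<alpha>) ae \<longleftrightarrow> \<not> eventually P ae"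
proof
  assume "eventually (\<lambda>\<alpha>. \<not> P \<alpha>) ae"
  show "\<not> eventually P ae"
  proof
    assume "eventually P ae"
    then have "eventually (\<lambda>_. False) ae"
      using \<open>eventually (\<lambda>\<alpha>. \<not> P \<alpha>) ae\<close> by eventually_elim blast
    then show False using ultrafilter by (simp add: eventually_ae ultrafilter_over_def)
  qed
next
  assume "\<not> eventually P ae"
  moreover have "{\<alpha> \<in> elts \<kappa>. \<not> P \<alpha>} = elts \<kappa> - {\<alpha> \<in> elts \<kappa>. P \<alpha>}" by blast
  moreover have "{\<alpha> \<in> elts \<kappa>. P \<alpha>} \<subseteq> elts \<kappa>" by blast
  ultimately show "eventually (\<lambda>\<alpha>. \<not> P \<alpha>) ae"
    using ultrafilter unfolding ultrafilter_over_def eventually_ae by metis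
qed

lemma eventually_ae_ex: "eventually P ae \<Longrightarrow> \<exists>\<alpha>\<in>elts \<kappa>. P \<alpha>"
  using ultrafilter unfolding eventually_ae ultrafilter_over_def by (metis (no_types, lifting) empty_Collect_eq)

lemma eventually_ae_const [simp]: "eventually (\<lambda>_. P) ae \<longleftrightarrow> P"
  using eventually_ae_ex by (cases P) auto

lemma eventually_ae_disj:
  "eventually (\<lambda>\<alpha>. P \<alpha> \<or> Q \<alpha>) ae \<longleftrightarrow> eventually P ae \<or> eventually Q ae"
  using eventually_ae_not[of P] eventually_ae_not[of Q] eventually_ae_not[of "\<lambda>\<alpha>. P \<alpha> \<or> Q \<alpha>"]
  by (simp add: eventually_conj_iff) blast

text \<open>The form in which sigma-completeness is applied: countably many almost-everywhere
  statements hold simultaneously.\<close>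

lemma eventually_ae_all_nat:
  fixes P :: "nat \<Rightarrow> 'v \<Rightarrow> bool"
  assumes "\<And>n. eventually (P n) ae" shows "eventually (\<lambda>\<alpha>. \<forall>n. P n \<alpha>) ae"
proof -
  have "(\<Inter>n. {\<alpha> \<in> elts \<kappa>. P n \<alpha>}) \<in> U"
    using assms
    by (intro sigma[unfolded sigma_complete_def, rule_format]) (simp add: eventually_ae)
  moreover have "(\<Inter>n. {\<alpha> \<in> elts \<kappa>. P n \<alpha>}) = {\<alpha> \<in> elts \<kappa>. \<forall>n. P n \<alpha>}" by blast
  ultimately show ?thesis by (simp add: eventually_ae)
qed

text \<open>The existential step of Los's theorem: pointwise witnesses form a function.\<close>

lemma eventually_ae_choice:
  assumes "eventually (\<lambda>\<alpha>. \<exists>x. Q \<alpha> x) ae" shows "\<exists>g. eventually (\<lambda>\<alpha>. Q \<alpha> (g \<alpha>)) ae"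
proof
  show "eventually (\<lambda>\<alpha>. Q \<alpha> (SOME x. Q \<alpha> x)) ae"
    using assms by eventually_elim (rule someI_ex)
qed

section \<open>The transitive collapse of the ultrapower\<close>

abbreviation "cl \<equiv> ult_class \<kappa> U"

lemma ult_mem_iff: "ult_mem \<kappa> U g f \<longleftrightarrow> eventually (\<lambda>\<alpha>. g \<alpha> \<in> elts (f \<alpha>)) ae"
  by (simp add: ult_mem_def eventually_ae)

text \<open>By sigma-completeness, a sequence descending in the ultrapower descends pointwise at a
  single index, against foundation.\<close>

lemma wf_ult_mem: "wf {(g, f). ult_mem \<kappa> U g f}"
  unfolding wf_iff_no_infinite_down_chain
proof
  assume "\<exists>s. \<forall>n. (s (Suc n), s n) \<in> {(g, f). ult_mem \<kappa> U g f}"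
  then obtain s :: "nat \<Rightarrow> 'v \<Rightarrow> 'v" where "\<And>n. eventually (\<lambda>\<alpha>. s (Suc n) \<alpha> \<in> elts (s n \<alpha>)) ae"
    by (auto simp: ult_mem_iff)
  then have "eventually (\<lambda>\<alpha>. \<forall>n. s (Suc n) \<alpha> \<in> elts (s n \<alpha>)) ae" by (rule eventually_ae_all_nat)
  then obtain \<alpha> where "\<forall>n. s (Suc n) \<alpha> \<in> elts (s n \<alpha>)" using eventually_ae_ex by blast
  then have "\<exists>t. \<forall>n. (t (Suc n), t n) \<in> {(x, y :: 'v). x \<in> elts y}"
    by (intro exI[of _ "\<lambda>n. s n \<alpha>"]) simp
  then show False using foundation unfolding wf_iff_no_infinite_down_chain by blast
qed

lemma ult_mem_cong:
  assumes "eventually (\<lambda>\<alpha>. f \<alpha> = g \<alpha>) ae"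
  shows "ult_mem \<kappa> U h f \<longleftrightarrow> ult_mem \<kappa> U h g"
  unfolding ult_mem_iff by (rule eventually_cong[OF assms]) simp

text \<open>Modulo \<open>ae\<close>, a \<open>U\<close>-member of \<open>f\<close> is coded by a subset of \<open>\<kappa> \<times> \<Union>\<^sub>\<alpha> f \<alpha>\<close>.\<close>

lemma small_ult_mem_image:
  fixes \<pi> :: "('v \<Rightarrow> 'v) \<Rightarrow> 'v"
  assumes cong: "\<And>g h. eventually (\<lambda>\<alpha>. g \<alpha> = h \<alpha>) ae \<Longrightarrow> \<pi> g = \<pi> h"
  shows "small {\<pi> g | g. ult_mem \<kappa> U g f}"
proof -
  define W where "W = (\<Union>\<alpha>\<in>elts \<kappa>. elts (f \<alpha>))"
  define P where "P = (\<Union>\<alpha>\<in>elts \<kappa>. vpair \<alpha> ` W)"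
  have "small W" unfolding W_def by (intro small_UN) simp_all
  then have P: "small P" unfolding P_def by (intro small_UN small_image) simp_all
  \<comment> \<open>Where the code contains no pair with first entry \<open>\<alpha>\<close>, the
    value is arbitrary; this happens only on a null set.\<close>
  define dec :: "'v \<Rightarrow> 'v \<Rightarrow> 'v" where "dec = (\<lambda>c \<alpha>. SOME b. vpair \<alpha> b \<in> elts c)"
  have "{\<pi> g | g. ult_mem \<kappa> U g f} \<subseteq> (\<lambda>c. \<pi> (dec c)) ` elts (vpow (vset P))"
  proof clarify
    fix g assume g: "ult_mem \<kappa> U g f"
    define G where "G = {vpair \<alpha> (g \<alpha>) | \<alpha>. \<alpha> \<in> elts \<kappa> \<and> g \<alpha> \<in> elts (f \<alpha>)}"
    have GP: "G \<subseteq> P" by (auto simp: G_def P_def W_def)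
    then have G: "elts (vset G) = G" using P elts_vset small_subset by blast
    have "eventually (\<lambda>\<alpha>. g \<alpha> = dec (vset G) \<alpha>) ae"
      using g[unfolded ult_mem_iff] eventually_ae_in
    proof eventually_elim
      case (elim \<alpha>)
      then have "vpair \<alpha> b \<in> G \<longleftrightarrow> b = g \<alpha>" for b by (auto simp: G_def)
      then show ?case by (simp add: dec_def G)
    qed
    then have "\<pi> g = \<pi> (dec (vset G))" by (rule cong)
    moreover have "vset G \<in> elts (vpow (vset P))"
      using GP G by (simp add: elts_vpow elts_vset[OF P])
    ultimately show "\<pi> g \<in> (\<lambda>c. \<pi> (dec c)) ` elts (vpow (vset P))" by blast
  qed
  then show ?thesis using small_subset small_image[OF small_elts] by blast
qed

text \<open>Existence and uniqueness of the collapse, by recursion and induction along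
  \<open>ult_mem\<close>, make the definite description in \<open>ult_class\<close>
  meaningful.\<close>

lemma elts_ult_class: "elts (cl f) = {cl g | g. ult_mem \<kappa> U g f}"
proof -
  define R where "R = {(g, f). ult_mem \<kappa> U g f}"
  have wfR: "wf R" unfolding R_def by (rule wf_ult_mem)
  define \<pi> :: "('v \<Rightarrow> 'v) \<Rightarrow> 'v" where "\<pi> = wfrec R (\<lambda>p f. vset {p g | g. (g, f) \<in> R})"
  have \<pi>: "\<pi> f = vset {\<pi> g | g. ult_mem \<kappa> U g f}" for f
  proof -
    have "\<pi> f = vset {cut \<pi> R f g | g. (g, f) \<in> R}"
      unfolding \<pi>_def by (subst wfrec[OF wfR]) simp
    moreover have "{cut \<pi> R f g | g. (g, f) \<in> R} = {\<pi> g | g. ult_mem \<kappa> U g f}"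
      by (auto simp: cut_def R_def)
    ultimately show ?thesis by simp
  qed
  \<comment> \<open>Congruence follows from the recursion equation alone, so it is available before
    the sets of values are known to be small.\<close>
  have "\<pi> g = \<pi> h" if "eventually (\<lambda>\<alpha>. g \<alpha> = h \<alpha>) ae" for g h
    by (subst (1 2) \<pi>) (simp add: ult_mem_cong[OF that])
  then have "small {\<pi> g | g. ult_mem \<kappa> U g f}" for f by (rule small_ult_mem_image)
  then have \<pi>_eq: "elts (\<pi> f) = {\<pi> g | g. ult_mem \<kappa> U g f}" for f
    by (subst \<pi>) (rule elts_vset)
  have "p = \<pi>" if p: "\<forall>f. elts (p f) = {p g | g. ult_mem \<kappa> U g f}" for p
  proof
    fix f show "p f = \<pi> f"
    proof (induction f rule: wf_induct_rule[OF wf_ult_mem])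
      case (1 f)
      have "{p g | g. ult_mem \<kappa> U g f} = {\<pi> g | g. ult_mem \<kappa> U g f}"
        unfolding setcompr_eq_image by (rule image_cong) (use 1 in auto)
      then have "elts (p f) = elts (\<pi> f)" using p \<pi>_eq by simp
      then show ?case by (rule extensionality)
    qed
  qed
  then have "cl = \<pi>"
    unfolding ult_class_def using \<pi>_eq by (intro the_equality) blast+
  then show ?thesis using \<pi>_eq by simp
qed

lemma ult_class_cong: "eventually (\<lambda>\<alpha>. f \<alpha> = g \<alpha>) ae \<Longrightarrow> cl f = cl g"
  by (rule extensionality) (simp add: elts_ult_class ult_mem_cong)

text \<open>If \<open>f\<close> and \<open>g\<close> differed almost everywhere, some
  \<open>h\<close> would select from the symmetric difference, on one fixed side almost everywhere.
  Equality of the classes gives a \<open>U\<close>-member of the other function with the same class.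
  Whichever of the two is a \<open>U\<close>-member of \<open>f\<close>, the induction hypothesis
  applies to it and equates them.\<close>

lemma ult_class_eq_imp:
  assumes "cl f = cl g" shows "eventually (\<lambda>\<alpha>. f \<alpha> = g \<alpha>) ae"
  using assms
proof (induction f arbitrary: g rule: wf_induct_rule[OF wf_ult_mem])
  case (1 f)
  show ?case
  proof (rule ccontr)
    assume "\<not> ?thesis"
    then have "eventually (\<lambda>\<alpha>. f \<alpha> \<noteq> g \<alpha>) ae" by (simp add: eventually_ae_not)
    then have "eventually (\<lambda>\<alpha>. \<exists>x. x \<in> elts (f \<alpha>) - elts (g \<alpha>) \<or> x \<in> elts (g \<alpha>) - elts (f \<alpha>)) ae"
      by eventually_elim (rule elts_differ)
    from eventually_ae_choice[OF this] obtain h where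
      "eventually (\<lambda>\<alpha>. h \<alpha> \<in> elts (f \<alpha>) - elts (g \<alpha>) \<or> h \<alpha> \<in> elts (g \<alpha>) - elts (f \<alpha>)) ae"
      by blast
    then have "eventually (\<lambda>\<alpha>. h \<alpha> \<in> elts (f \<alpha>) - elts (g \<alpha>)) ae \<or>
        eventually (\<lambda>\<alpha>. h \<alpha> \<in> elts (g \<alpha>) - elts (f \<alpha>)) ae"
      by (simp only: eventually_ae_disj)
    then show False
    proof
      assume h: "eventually (\<lambda>\<alpha>. h \<alpha> \<in> elts (f \<alpha>) - elts (g \<alpha>)) ae"
      have hf: "ult_mem \<kappa> U h f" unfolding ult_mem_iff using h by eventually_elim blast
      then have "cl h \<in> elts (cl g)" using elts_ult_class[of f] 1(2) by auto
      then obtain k where k: "cl h = cl k" "ult_mem \<kappa> U k g" using elts_ult_class[of g] by auto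
      have "eventually (\<lambda>\<alpha>. h \<alpha> = k \<alpha>) ae" using 1(1) hf k(1) by blast
      then have "eventually (\<lambda>_. False) ae"
        using k(2)[unfolded ult_mem_iff] h by eventually_elim simp
      then show False by simp
    next
      assume h: "eventually (\<lambda>\<alpha>. h \<alpha> \<in> elts (g \<alpha>) - elts (f \<alpha>)) ae"
      have "ult_mem \<kappa> U h g" unfolding ult_mem_iff using h by eventually_elim blast
      then have "cl h \<in> elts (cl f)" using elts_ult_class[of g] 1(2) by auto
      then obtain k where k: "cl k = cl h" "ult_mem \<kappa> U k f"
        using elts_ult_class[of f] by auto
      have "eventually (\<lambda>\<alpha>. k \<alpha> = h \<alpha>) ae" using 1(1) k by blast
      then have "eventually (\<lambda>_. False) ae"
        using k(2)[unfolded ult_mem_iff] h by eventually_elim simp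
      then show False by simp
    qed
  qed
qed

lemma ult_class_eq_iff: "cl f = cl g \<longleftrightarrow> eventually (\<lambda>\<alpha>. f \<alpha> = g \<alpha>) ae"
  using ult_class_cong ult_class_eq_imp by blast

lemma ult_class_mem_iff: "cl g \<in> elts (cl f) \<longleftrightarrow> eventually (\<lambda>\<alpha>. g \<alpha> \<in> elts (f \<alpha>)) ae"
proof
  assume "cl g \<in> elts (cl f)"
  then obtain h where "cl g = cl h" "ult_mem \<kappa> U h f" using elts_ult_class[of f] by auto
  then show "eventually (\<lambda>\<alpha>. g \<alpha> \<in> elts (f \<alpha>)) ae"
    unfolding ult_class_eq_iff ult_mem_iff by (rule eventually_elim2) simp
qed (auto simp: elts_ult_class ult_mem_iff)

lemma ult_class_transitive: "x \<in> elts (cl f) \<Longrightarrow> \<exists>g. x = cl g"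
  by (auto simp: elts_ult_class)

section \<open>Pairs, intersections and Dodd soundness in the ultrapower\<close>

lemma ult_class_eqI:
  assumes "\<And>g. eventually (\<lambda>\<alpha>. g \<alpha> \<in> elts (f \<alpha>)) ae \<longleftrightarrow> cl g \<in> S" and "S \<subseteq> range cl"
  shows "elts (cl f) = S"
  using assms by (fastforce simp: elts_ult_class ult_mem_iff)

lemma ult_class_doubleton: "cl (\<lambda>\<alpha>. vset {x \<alpha>, y \<alpha>}) = vset {cl x, cl y}"
proof -
  have "elts (cl (\<lambda>\<alpha>. vset {x \<alpha>, y \<alpha>})) = {cl x, cl y}"
    by (rule ult_class_eqI)
      (auto simp: elts_vset[OF small_doubleton] eventually_ae_disj ult_class_eq_iff)
  then show ?thesis by (metis vset_elts)
qed

lemma ult_class_vpair: "cl (\<lambda>\<alpha>. vpair (x \<alpha>) (y \<alpha>)) = vpair (cl x) (cl y)"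
  using ult_class_doubleton[of x x] unfolding vpair_def by (simp add: ult_class_doubleton)

lemma ult_class_Int:
  "cl (\<lambda>\<alpha>. vset (elts (x \<alpha>) \<inter> elts (y \<alpha>))) = vset (elts (cl x) \<inter> elts (cl y))"
proof -
  have "elts (vset (elts (x \<alpha>) \<inter> elts (y \<alpha>))) = elts (x \<alpha>) \<inter> elts (y \<alpha>)" for \<alpha>
    by (rule vset_Pow_elts[of _ "x \<alpha>"]) blast
  then have "elts (cl (\<lambda>\<alpha>. vset (elts (x \<alpha>) \<inter> elts (y \<alpha>)))) = elts (cl x) \<inter> elts (cl y)"
    by (intro ult_class_eqI)
      (auto simp: eventually_conj_iff ult_class_mem_iff dest: ult_class_transitive)
  then show ?thesis by (metis vset_elts)
qed

text \<open>The family \<open>\<A>\<close> represents \<open>{j(X) \<inter> [id] | X \<subseteq> \<kappa>}\<close>, which is the range of the function in the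
  definition of Dodd soundness.\<close>

lemma dodd_sound_family:
  assumes "dodd_sound \<kappa> U"
  shows "\<exists>\<A> :: 'v \<Rightarrow> 'v set set.
    (\<forall>X \<subseteq> elts \<kappa>. eventually (\<lambda>\<alpha>. X \<inter> elts \<alpha> \<in> \<A> \<alpha>) ae) \<and>
    (\<forall>g. eventually (\<lambda>\<alpha>. g \<alpha> \<in> \<A> \<alpha>) ae \<longrightarrow>
      (\<exists>X \<subseteq> elts \<kappa>. eventually (\<lambda>\<alpha>. g \<alpha> = X \<inter> elts \<alpha>) ae))"
proof -
  define Y where "Y = (\<lambda>X. vset (elts (ult_emb \<kappa> U X) \<inter> elts (cl (\<lambda>\<alpha>. \<alpha>))))"
  have Y: "Y X = cl (\<lambda>\<alpha>. vset (elts X \<inter> elts \<alpha>))" for X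
    unfolding Y_def ult_emb_def by (simp add: ult_class_Int)
  have vs: "elts (vset (elts X \<inter> elts \<alpha>)) = elts X \<inter> elts \<alpha>" for X \<alpha> :: 'v
    by (rule vset_Pow_elts[of _ X]) blast
  define S where "S = {vpair X (Y X) | X. X \<in> elts (vpow \<kappa>)}"
  have "S = (\<lambda>X. vpair X (Y X)) ` elts (vpow \<kappa>)" by (auto simp: S_def)
  then have "small S" by (simp add: small_image)
  moreover obtain f where f: "vset S = cl f"
    using assms unfolding dodd_sound_def ult_model_def S_def Y_def by auto
  ultimately have S: "elts (cl f) = S" using elts_vset by metis
  \<comment> \<open>The second components of the pairs in \<open>f \<alpha>\<close>, that is, the
    range of the represented function, read as HOL sets.\<close>
  define \<A> where "\<A> = (\<lambda>\<alpha>. {elts y | x y. vpair x y \<in> elts (f \<alpha>)})"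
  have "eventually (\<lambda>\<alpha>. X \<inter> elts \<alpha> \<in> \<A> \<alpha>) ae" if X: "X \<subseteq> elts \<kappa>" for X
  proof -
    have eX: "elts (vset X) = X" using X by (rule vset_Pow_elts)
    then have p: "vpair (vset X) (Y (vset X)) \<in> elts (cl f)"
      using X by (auto simp: S S_def elts_vpow)
    \<comment> \<open>Transitivity of the ultrapower, applied through the layers of the pair, yields
      a representative \<open>x\<close> of \<open>vset X\<close>, so that the whole pair can be
      evaluated pointwise.\<close>
    then obtain p where "vpair (vset X) (Y (vset X)) = cl p" using ult_class_transitive by blast
    moreover from this have "vset {vset X, Y (vset X)} \<in> elts (cl p)" by (metis elts_vpair insertCI)
    then obtain q where q: "vset {vset X, Y (vset X)} = cl q" using ult_class_transitive by blast
    then have "vset X \<in> elts (cl q)" by (metis elts_vset insertCI small_doubleton)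
    then obtain x where "vset X = cl x" using ult_class_transitive by blast
    with p have "cl (\<lambda>\<alpha>. vpair (x \<alpha>) (vset (elts (vset X) \<inter> elts \<alpha>))) \<in> elts (cl f)"
      by (simp only: ult_class_vpair Y)
    then have "eventually (\<lambda>\<alpha>. vpair (x \<alpha>) (vset (X \<inter> elts \<alpha>)) \<in> elts (f \<alpha>)) ae"
      by (simp add: ult_class_mem_iff eX)
    then show ?thesis
    proof eventually_elim
      case (elim \<alpha>)
      then have "elts (vset (X \<inter> elts \<alpha>)) \<in> \<A> \<alpha>" unfolding \<A>_def by blast
      then show ?case using vs[of "vset X" \<alpha>] by (simp add: eX)
    qed
  qed
  moreover have "\<exists>X \<subseteq> elts \<kappa>. eventually (\<lambda>\<alpha>. g \<alpha> = X \<inter> elts \<alpha>) ae"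
    if "eventually (\<lambda>\<alpha>. g \<alpha> \<in> \<A> \<alpha>) ae" for g
  proof -
    have "eventually (\<lambda>\<alpha>. \<exists>p. g \<alpha> = elts (snd p) \<and> vpair (fst p) (snd p) \<in> elts (f \<alpha>)) ae"
      using that by eventually_elim (auto simp: \<A>_def)
    from eventually_ae_choice[OF this] obtain p where p:
      "eventually (\<lambda>\<alpha>. g \<alpha> = elts (snd (p \<alpha>)) \<and> vpair (fst (p \<alpha>)) (snd (p \<alpha>)) \<in> elts (f \<alpha>)) ae"
      by blast
    then have "cl (\<lambda>\<alpha>. vpair (fst (p \<alpha>)) (snd (p \<alpha>))) \<in> elts (cl f)"
      unfolding ult_class_mem_iff by eventually_elim blast
    then have "vpair (cl (\<lambda>\<alpha>. fst (p \<alpha>))) (cl (\<lambda>\<alpha>. snd (p \<alpha>))) \<in> S"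
      by (simp add: ult_class_vpair S)
    then obtain X where X: "X \<in> elts (vpow \<kappa>)" "cl (\<lambda>\<alpha>. snd (p \<alpha>)) = Y X"
      by (auto simp: S_def)
    then have "eventually (\<lambda>\<alpha>. snd (p \<alpha>) = vset (elts X \<inter> elts \<alpha>)) ae"
      by (simp add: Y ult_class_eq_iff)
    with p have "eventually (\<lambda>\<alpha>. g \<alpha> = elts X \<inter> elts \<alpha>) ae"
      by eventually_elim (simp add: vs)
    then show ?thesis using X(1) by (auto simp: elts_vpow)
  qed
  ultimately show ?thesis by blast
qed

end

text \<open>If \<open>\<alpha>\<close> were below \<open>e (f \<alpha>)\<close> on a set in
  \<open>U\<close>, then \<open>e x\<close> would bound the fibre of \<open>f\<close> over each
  \<open>x\<close> within that set, making \<open>f\<close> almost one-to-one.\<close>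

lemma (in sigma_ultrafilter) not_p_point_fibers:
  assumes "\<not> p_point \<kappa> U" and "ordinal \<kappa>"
  shows "\<exists>f. f \<in> elts \<kappa> \<rightarrow> elts \<kappa> \<and> (\<forall>\<xi>\<in>elts \<kappa>. eventually (\<lambda>\<alpha>. f \<alpha> \<notin> elts \<xi>) ae) \<and>
    (\<forall>e \<in> elts \<kappa> \<rightarrow> elts \<kappa>. eventually (\<lambda>\<alpha>. \<alpha> \<notin> elts (e (f \<alpha>))) ae)"
proof -
  obtain f where f: "f \<in> elts \<kappa> \<rightarrow> elts \<kappa>" "unbounded_mod \<kappa> U f" "\<not> almost_one_to_one_mod \<kappa> U f"
    using assms(1) unfolding p_point_def by blast
  have "eventually (\<lambda>\<alpha>. f \<alpha> \<notin> elts \<xi>) ae" if "\<xi> \<in> elts \<kappa>" for \<xi>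
    using f(2) that unfolding unbounded_mod_def eventually_ae_not by (simp add: eventually_ae)
  moreover have "eventually (\<lambda>\<alpha>. \<alpha> \<notin> elts (e (f \<alpha>))) ae" if e: "e \<in> elts \<kappa> \<rightarrow> elts \<kappa>" for e
    unfolding eventually_ae_not
  proof
    define A where "A = {\<alpha> \<in> elts \<kappa>. \<alpha> \<in> elts (e (f \<alpha>))}"
    assume "eventually (\<lambda>\<alpha>. \<alpha> \<in> elts (e (f \<alpha>))) ae"
    then have A: "A \<in> U" by (simp add: eventually_ae A_def)
    have "bounded_in \<kappa> {\<alpha> \<in> A. f \<alpha> = x}" for x
    proof (cases "x \<in> elts \<kappa>")
      case True
      then have "e x \<in> elts \<kappa>" using e by blast
      then show ?thesis unfolding bounded_in_def by (intro bexI[of _ "e x"]) (auto simp: A_def)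
    next
      case False
      then have "{\<alpha> \<in> A. f \<alpha> = x} = {}" using f(1) by (auto simp: A_def)
      moreover obtain \<alpha> where "\<alpha> \<in> elts \<kappa>" using eventually_ae_ex[OF eventually_ae_in] by blast
      ultimately show ?thesis unfolding bounded_in_def by auto
    qed
    then show False using f(3) A unfolding almost_one_to_one_mod_def by blast
  qed
  ultimately show ?thesis using f(1) by blast
qed

section \<open>Dodd sound ultrafilters that are not p-points\<close>

locale dodd_family = sigma_ultrafilter \<kappa> U for \<kappa> :: "'v::zfc_universe" and U +
  fixes \<A> :: "'v \<Rightarrow> 'v set set" and f :: "'v \<Rightarrow> 'v"
  assumes regular: "regular_cardinal \<kappa>"
    and trace: "\<And>X. X \<subseteq> elts \<kappa> \<Longrightarrow> eventually (\<lambda>\<alpha>. X \<inter> elts \<alpha> \<in> \<A> \<alpha>) ae"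
    and selection: "\<And>g. eventually (\<lambda>\<alpha>. g \<alpha> \<in> \<A> \<alpha>) ae \<Longrightarrow>
      \<exists>X \<subseteq> elts \<kappa>. eventually (\<lambda>\<alpha>. g \<alpha> = X \<inter> elts \<alpha>) ae"
    and f_funcset: "f \<in> elts \<kappa> \<rightarrow> elts \<kappa>"
    and f_unbounded: "\<And>\<xi>. \<xi> \<in> elts \<kappa> \<Longrightarrow> eventually (\<lambda>\<alpha>. f \<alpha> \<notin> elts \<xi>) ae"
    and f_fibers: "\<And>e. e \<in> elts \<kappa> \<rightarrow> elts \<kappa> \<Longrightarrow> eventually (\<lambda>\<alpha>. \<alpha> \<notin> elts (e (f \<alpha>))) ae"
begin

section \<open>Regularity and the traces of subsets of \<kappa>\<close>

lemma ordinal_\<kappa>: "ordinal \<kappa>"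
  using regular by (simp add: regular_cardinal_def cardinal_def)

lemma ordinal_below: "\<xi> \<in> elts \<kappa> \<Longrightarrow> ordinal \<xi>"
  using ordinal_\<kappa> by (rule ordinal_mem)

lemma elts_lesspoll: "\<xi> \<in> elts \<kappa> \<Longrightarrow> elts \<xi> \<prec> elts \<kappa>"
  unfolding lesspoll_def using regular ordinal_trans[OF ordinal_\<kappa>]
  by (auto simp: regular_cardinal_def cardinal_def intro: subset_imp_lepoll)

lemma bounded:
  assumes "S \<subseteq> elts \<kappa>" "S \<prec> elts \<kappa>" shows "\<exists>\<beta>\<in>elts \<kappa>. S \<subseteq> elts \<beta>"
  using assms regular unfolding regular_cardinal_def bounded_in_def by blast

text \<open>Regularity is applied twice: to each row \<open>g \<xi>\<close>, then to the bounds of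
  the rows.\<close>

lemma bounded_image2:
  assumes \<theta>: "\<theta> \<in> elts \<kappa>" and g: "\<And>\<xi> \<eta>. \<xi> \<in> elts \<theta> \<Longrightarrow> \<eta> \<in> elts \<theta> \<Longrightarrow> g \<xi> \<eta> \<in> elts \<kappa>"
  shows "\<exists>\<beta>\<in>elts \<kappa>. \<forall>\<xi>\<in>elts \<theta>. \<forall>\<eta>\<in>elts \<theta>. g \<xi> \<eta> \<in> elts \<beta>"
proof -
  have small_image_bounded: "\<exists>\<beta>\<in>elts \<kappa>. h ` elts \<theta> \<subseteq> elts \<beta>" if "h ` elts \<theta> \<subseteq> elts \<kappa>" for h
    using that lesspoll_trans1[OF image_lepoll elts_lesspoll[OF \<theta>]] by (rule bounded)
  have "\<forall>\<xi>\<in>elts \<theta>. \<exists>\<beta>\<in>elts \<kappa>. g \<xi> ` elts \<theta> \<subseteq> elts \<beta>"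
    using g by (intro ballI small_image_bounded) blast
  then obtain b where b: "\<forall>\<xi>\<in>elts \<theta>. b \<xi> \<in> elts \<kappa> \<and> g \<xi> ` elts \<theta> \<subseteq> elts (b \<xi>)" by metis
  then obtain \<beta> where \<beta>: "\<beta> \<in> elts \<kappa>" "b ` elts \<theta> \<subseteq> elts \<beta>"
    using small_image_bounded[of b] by blast
  have "g \<xi> \<eta> \<in> elts \<beta>" if "\<xi> \<in> elts \<theta>" "\<eta> \<in> elts \<theta>" for \<xi> \<eta>
    using that b \<beta>(2) ordinal_trans[OF ordinal_below[OF \<beta>(1)], of "b \<xi>" "g \<xi> \<eta>"] by blast
  then show ?thesis using \<beta>(1) by blast
qed

lemma eventually_mem_index:
  assumes \<xi>: "\<xi> \<in> elts \<kappa>" shows "eventually (\<lambda>\<alpha>. \<xi> \<in> elts \<alpha>) ae"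
proof -
  have "infinite (elts \<kappa>)" using regular by (simp add: regular_cardinal_def)
  then have "{\<xi>} \<prec> elts \<kappa>" by (intro finite_lesspoll_infinite) simp_all
  then obtain \<beta> where \<beta>: "\<beta> \<in> elts \<kappa>" "\<xi> \<in> elts \<beta>" using bounded[of "{\<xi>}"] \<xi> by blast
  \<comment> \<open>For a constant \<open>e\<close>, the fibre condition says that proper initial
    segments of \<kappa> are null.\<close>
  have "eventually (\<lambda>\<alpha>. \<alpha> \<notin> elts \<beta>) ae" using f_fibers[of "\<lambda>_. \<beta>"] \<beta>(1) by simp
  with eventually_ae_in show ?thesis
  proof eventually_elim
    case (elim \<alpha>)
    then show ?case
      using ordinal_linear[of \<alpha> \<beta>] ordinal_trans[of \<alpha> \<beta> \<xi>] ordinal_below \<beta> by blast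
  qed
qed

text \<open>\<open>B\<close> represents \<open>{j(\<xi>) | \<xi> < \<kappa>}\<close>: a singleton is of the form \<open>j(X) \<inter> [id]\<close> iff it is
  \<open>{j(\<xi>)}\<close> for some \<open>\<xi>\<close>.\<close>

definition B :: "'v \<Rightarrow> 'v set" where
  "B \<alpha> = {\<nu> \<in> elts \<alpha>. {\<nu>} \<in> \<A> \<alpha>}"

lemma eventually_mem_B:
  assumes "\<xi> \<in> elts \<kappa>" shows "eventually (\<lambda>\<alpha>. \<xi> \<in> B \<alpha>) ae"
  using trace[of "{\<xi>}"] eventually_mem_index[OF assms] assms
  by (auto simp: B_def elim: eventually_elim2)

text \<open>The singletons \<open>{g \<alpha>}\<close> select from \<open>\<A>\<close>, hence are
  the traces of a single \<open>X\<close>. Any element of \<open>X\<close> lies in almost every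
  index and is therefore the value of \<open>g\<close> there.\<close>

lemma selection_B:
  assumes "eventually (\<lambda>\<alpha>. g \<alpha> \<in> B \<alpha>) ae"
  shows "\<exists>\<xi>\<in>elts \<kappa>. eventually (\<lambda>\<alpha>. g \<alpha> = \<xi>) ae"
proof -
  have "eventually (\<lambda>\<alpha>. {g \<alpha>} \<in> \<A> \<alpha>) ae"
    using assms by eventually_elim (simp add: B_def)
  then obtain X where X: "X \<subseteq> elts \<kappa>" "eventually (\<lambda>\<alpha>. {g \<alpha>} = X \<inter> elts \<alpha>) ae"
    using selection[of "\<lambda>\<alpha>. {g \<alpha>}"] by blast
  then obtain \<alpha> where "{g \<alpha>} = X \<inter> elts \<alpha>" using eventually_ae_ex by blast
  then obtain \<xi> where \<xi>: "\<xi> \<in> X" by blast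
  then have "\<xi> \<in> elts \<kappa>" using X(1) by blast
  moreover from X(2) eventually_mem_index[OF this] have "eventually (\<lambda>\<alpha>. g \<alpha> = \<xi>) ae"
  proof eventually_elim
    case (elim \<alpha>)
    then have "\<xi> \<in> {g \<alpha>}" using \<xi> by blast
    then show ?case by simp
  qed
  ultimately show ?thesis by blast
qed

text \<open>Intersecting with \<open>B \<alpha>\<close> is injective on
  \<open>\<A> \<alpha>\<close>: two distinct selections are traces of distinct sets \<open>X\<close>
  and \<open>Y\<close>, and a point at which these differ lies in almost every
  \<open>B \<alpha>\<close>.\<close>

lemma eventually_\<A>_lepoll: "eventually (\<lambda>\<alpha>. \<A> \<alpha> \<lesssim> Pow (B \<alpha>)) ae"
proof -
  have "eventually (\<lambda>\<alpha>. inj_on (\<lambda>Y. Y \<inter> B \<alpha>) (\<A> \<alpha>)) ae"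
  proof (rule ccontr)
    assume "\<not> ?thesis"
    then have "eventually (\<lambda>\<alpha>. \<exists>p. fst p \<in> \<A> \<alpha> \<and> snd p \<in> \<A> \<alpha> \<and> fst p \<noteq> snd p
        \<and> fst p \<inter> B \<alpha> = snd p \<inter> B \<alpha>) ae"
      unfolding eventually_ae_not[symmetric] by eventually_elim (auto simp: inj_on_def)
    from eventually_ae_choice[OF this] obtain p where p: "eventually (\<lambda>\<alpha>. fst (p \<alpha>) \<in> \<A> \<alpha> \<and>
        snd (p \<alpha>) \<in> \<A> \<alpha> \<and> fst (p \<alpha>) \<noteq> snd (p \<alpha>) \<and> fst (p \<alpha>) \<inter> B \<alpha> = snd (p \<alpha>) \<inter> B \<alpha>) ae"
      by blast
    have "eventually (\<lambda>\<alpha>. fst (p \<alpha>) \<in> \<A> \<alpha>) ae" using p by eventually_elim blast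
    from selection[OF this] obtain X where
      X: "X \<subseteq> elts \<kappa>" "eventually (\<lambda>\<alpha>. fst (p \<alpha>) = X \<inter> elts \<alpha>) ae" by blast
    have "eventually (\<lambda>\<alpha>. snd (p \<alpha>) \<in> \<A> \<alpha>) ae" using p by eventually_elim blast
    from selection[OF this] obtain Y where
      Y: "Y \<subseteq> elts \<kappa>" "eventually (\<lambda>\<alpha>. snd (p \<alpha>) = Y \<inter> elts \<alpha>) ae" by blast
    have "eventually (\<lambda>\<alpha>. X \<noteq> Y) ae" using p X(2) Y(2) by eventually_elim auto
    then obtain \<xi> where \<xi>: "\<xi> \<in> elts \<kappa>" "\<xi> \<in> X \<longleftrightarrow> \<xi> \<notin> Y" using X(1) Y(1) by auto
    from p X(2) Y(2) eventually_mem_index[OF \<xi>(1)] eventually_mem_B[OF \<xi>(1)]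
    have "eventually (\<lambda>_. False) ae" by eventually_elim (use \<xi>(2) in blast)
    then show False by simp
  qed
  then show ?thesis
  proof eventually_elim
    case (elim \<alpha>)
    then show ?case unfolding lepoll_def by (intro exI[of _ "\<lambda>Y. Y \<inter> B \<alpha>"]) auto
  qed
qed

text \<open>An injection \<open>e\<close> of \<open>M\<close> into \<open>Pow N\<close> remains
  injective on \<open>B \<alpha> \<inter> M\<close> after its values are cut down to
  \<open>B \<alpha>\<close>: a pair of counterexamples would be constant almost everywhere, while
  \<open>B\<close> eventually contains every point of \<kappa>.\<close>

lemma eventually_B_lepoll_Pow:
  assumes M: "M \<lesssim> Pow N" and N: "N \<subseteq> elts \<kappa>"
  shows "eventually (\<lambda>\<alpha>. B \<alpha> \<inter> M \<lesssim> Pow (B \<alpha> \<inter> N)) ae"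
proof -
  obtain e where e: "inj_on e M" "e ` M \<subseteq> Pow N" using M by (auto simp: lepoll_def)
  have "eventually (\<lambda>\<alpha>. inj_on (\<lambda>\<xi>. e \<xi> \<inter> B \<alpha>) (B \<alpha> \<inter> M)) ae"
  proof (rule ccontr)
    assume "\<not> ?thesis"
    then have "eventually (\<lambda>\<alpha>. \<exists>p. fst p \<in> B \<alpha> \<inter> M \<and> snd p \<in> B \<alpha> \<inter> M \<and> fst p \<noteq> snd p
        \<and> e (fst p) \<inter> B \<alpha> = e (snd p) \<inter> B \<alpha>) ae"
      unfolding eventually_ae_not[symmetric] by eventually_elim (auto simp: inj_on_def)
    from eventually_ae_choice[OF this] obtain p where p: "eventually (\<lambda>\<alpha>. fst (p \<alpha>) \<in> B \<alpha> \<inter> M \<and>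
        snd (p \<alpha>) \<in> B \<alpha> \<inter> M \<and> fst (p \<alpha>) \<noteq> snd (p \<alpha>) \<and>
        e (fst (p \<alpha>)) \<inter> B \<alpha> = e (snd (p \<alpha>)) \<inter> B \<alpha>) ae"
      by blast
    have "eventually (\<lambda>\<alpha>. fst (p \<alpha>) \<in> B \<alpha>) ae" using p by eventually_elim blast
    from selection_B[OF this] obtain \<xi> where \<xi>: "eventually (\<lambda>\<alpha>. fst (p \<alpha>) = \<xi>) ae" by blast
    have "eventually (\<lambda>\<alpha>. snd (p \<alpha>) \<in> B \<alpha>) ae" using p by eventually_elim blast
    from selection_B[OF this] obtain \<eta> where \<eta>: "eventually (\<lambda>\<alpha>. snd (p \<alpha>) = \<eta>) ae" by blast
    from p \<xi> \<eta> have "eventually (\<lambda>\<alpha>. \<xi> \<in> M \<and> \<eta> \<in> M \<and> \<xi> \<noteq> \<eta> \<and> e \<xi> \<inter> B \<alpha> = e \<eta> \<inter> B \<alpha>) ae"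
      by eventually_elim auto
    then have M: "\<xi> \<in> M" "\<eta> \<in> M" "\<xi> \<noteq> \<eta>" and eq: "eventually (\<lambda>\<alpha>. e \<xi> \<inter> B \<alpha> = e \<eta> \<inter> B \<alpha>) ae"
      by (simp_all add: eventually_conj_iff)
    then have "e \<xi> \<noteq> e \<eta>" using e(1) by (meson inj_onD)
    then obtain \<zeta> where \<zeta>: "\<zeta> \<in> e \<xi> \<longleftrightarrow> \<zeta> \<notin> e \<eta>" by blast
    then have "\<zeta> \<in> elts \<kappa>" using M e(2) N by blast
    from eq eventually_mem_B[OF this] have "eventually (\<lambda>_. False) ae"
      by eventually_elim (use \<zeta> in blast)
    then show False by simp
  qed
  then show ?thesis
  proof eventually_elim
    case (elim \<alpha>)
    moreover have "(\<lambda>\<xi>. e \<xi> \<inter> B \<alpha>) ` (B \<alpha> \<inter> M) \<subseteq> Pow (B \<alpha> \<inter> N)" using e(2) by blast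
    ultimately show ?case unfolding lepoll_def by blast
  qed
qed

text \<open>A selection from \<open>B\<close> is constant almost everywhere, and \<open>f\<close>
  eventually exceeds every constant below \<kappa>.\<close>

lemma eventually_B_subset_f: "eventually (\<lambda>\<alpha>. B \<alpha> \<subseteq> elts (f \<alpha>)) ae"
proof (rule ccontr)
  assume "\<not> ?thesis"
  then have "eventually (\<lambda>\<alpha>. \<exists>\<nu>. \<nu> \<in> B \<alpha> \<and> \<nu> \<notin> elts (f \<alpha>)) ae"
    unfolding eventually_ae_not[symmetric] by eventually_elim auto
  from eventually_ae_choice[OF this] obtain g
    where g: "eventually (\<lambda>\<alpha>. g \<alpha> \<in> B \<alpha> \<and> g \<alpha> \<notin> elts (f \<alpha>)) ae" by blast
  then have "eventually (\<lambda>\<alpha>. g \<alpha> \<in> B \<alpha>) ae" by eventually_elim blast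
  from selection_B[OF this] obtain \<xi> where \<xi>: "\<xi> \<in> elts \<kappa>" "eventually (\<lambda>\<alpha>. g \<alpha> = \<xi>) ae" by blast
  have "infinite (elts \<kappa>)" using regular by (simp add: regular_cardinal_def)
  then have "{\<xi>} \<prec> elts \<kappa>" by (intro finite_lesspoll_infinite) simp_all
  then obtain \<beta> where \<beta>: "\<beta> \<in> elts \<kappa>" "\<xi> \<in> elts \<beta>" using bounded[of "{\<xi>}"] \<xi>(1) by blast
  from g \<xi>(2) f_unbounded[OF \<beta>(1)] eventually_ae_in have "eventually (\<lambda>_. False) ae"
  proof eventually_elim
    case (elim \<alpha>)
    then have "ordinal (f \<alpha>)" using f_funcset ordinal_below by blast
    then have "\<xi> \<in> elts (f \<alpha>)"
      using elim(3) \<beta> ordinal_linear[of "f \<alpha>" \<beta>] ordinal_trans[of "f \<alpha>" \<beta> \<xi>] ordinal_below by blast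
    then show ?case using elim by simp
  qed
  then show False by simp
qed

text \<open>Strong limits are taken as initial segments of \<open>\<kappa>\<close>, so that \<open>\<kappa>\<close> itself is not a special case.\<close>

definition strong_limit :: "'v set \<Rightarrow> bool" where
  "strong_limit D \<longleftrightarrow> D \<subseteq> elts \<kappa> \<and> (\<forall>x\<in>D. elts x \<subseteq> D \<and> Pow (elts x) \<prec> D)"

section \<open>Strong limits and Kunen's argument\<close>

lemma strong_limit_lesspoll:
  assumes D: "strong_limit D" and A: "A \<prec> D" shows "\<exists>a\<in>D. A \<approx> elts a"
proof -
  have "\<exists>a\<in>D. A \<approx> D \<inter> elts a"
    using A by (rule lesspoll_initial_segment[rotated]) (use D ordinal_below in \<open>auto simp: strong_limit_def\<close>)
  moreover have "D \<inter> elts a = elts a" if "a \<in> D" for a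
    using that D by (auto simp: strong_limit_def)
  ultimately show ?thesis by auto
qed

lemma strong_limit_Pow:
  assumes D: "strong_limit D" and A: "A \<prec> D" shows "Pow A \<prec> D"
proof -
  obtain a where a: "a \<in> D" "A \<approx> elts a" using strong_limit_lesspoll[OF assms] by blast
  have "Pow A \<lesssim> Pow (elts a)" using a(2) by (intro Pow_lepoll_mono eqpoll_imp_lepoll)
  then show ?thesis using D a(1) unfolding strong_limit_def using lesspoll_trans1 by blast
qed

text \<open>Says that the class of \<open>h\<close> is not in the range of the ultrapower
  embedding.\<close>

abbreviation nonconstant :: "('v \<Rightarrow> 'v) \<Rightarrow> bool" where
  "nonconstant h \<equiv> \<forall>c. \<not> eventually (\<lambda>\<alpha>. h \<alpha> = c) ae"

text \<open>The combinatorial core of Kunen's inconsistency theorem: \<open>j(\<delta>) = \<delta>\<close> is impossible if \<open>\<delta>\<close> is a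
  strong limit of cofinality \<open>\<omega>\<close> above the critical point and \<open>{j(\<xi>) | \<xi> < \<delta>}\<close> is in the ultrapower.\<close>

lemma kunen:
  fixes lam :: "nat \<Rightarrow> 'v"
  assumes lam: "\<And>n. lam n \<in> elts \<kappa>"
    and large: "\<And>n. eventually (\<lambda>\<alpha>. Pow (elts (lam n)) \<lesssim> B \<alpha> \<inter> elts (lam (Suc n))) ae"
    and h: "eventually (\<lambda>\<alpha>. h \<alpha> \<in> elts (lam 0)) ae" "nonconstant h"
  shows False
proof -
  define L where "L = (\<Union>n. elts (lam n))"
  have lam_Suc: "lam n \<in> elts (lam (Suc n))" for n
  proof (rule ccontr)
    assume "lam n \<notin> elts (lam (Suc n))"
    then have "elts (lam (Suc n)) \<subseteq> elts (lam n)"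
      using ordinal_subset_iff[of "lam (Suc n)" "lam n"] ordinal_below lam by blast
    moreover obtain \<alpha> where "Pow (elts (lam n)) \<lesssim> B \<alpha> \<inter> elts (lam (Suc n))"
      using eventually_ae_ex[OF large[of n]] by blast
    ultimately have "Pow (elts (lam n)) \<lesssim> elts (lam n)"
      using lepoll_trans subset_imp_lepoll by (metis inf.coboundedI2)
    then show False using lesspoll_Pow_self[of "elts (lam n)"] not_lepoll_iff_lesspoll by blast
  qed
  have lam_less: "lam m \<in> elts (lam n)" if "m < n" for m n
    using that
  proof (induction rule: less_Suc_induct)
    case (2 i j k)
    then show ?case using ordinal_trans[OF ordinal_below[OF lam]] by blast
  qed (rule lam_Suc)
  have "inj lam" by (rule linorder_injI) (use lam_less mem_irrefl in metis)
  moreover have "range lam \<subseteq> L" using lam_Suc by (auto simp: L_def)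
  ultimately have "infinite L" using finite_subset finite_imageD infinite_UNIV_nat by metis
  then obtain J :: "(nat \<Rightarrow> 'v) \<Rightarrow> 'v" where J: "\<And>S y. S \<subseteq> L \<Longrightarrow> (\<And>n. Pow (elts (lam n)) \<lesssim> S) \<Longrightarrow> y \<in> L
      \<Longrightarrow> \<exists>s. range s \<subseteq> S \<and> J s = y"
    using jonsson_function_exists[of "\<lambda>n. elts (lam n)"] unfolding L_def by metis
  have "eventually (\<lambda>\<alpha>. \<forall>n. Pow (elts (lam n)) \<lesssim> B \<alpha> \<inter> elts (lam (Suc n))) ae"
    using large by (rule eventually_ae_all_nat)
  \<comment> \<open>\<open>B \<alpha> \<inter> L\<close> is large enough for the Jonsson property,
    so \<open>h \<alpha>\<close> is the value of \<open>J\<close> at a sequence from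
    \<open>B \<alpha>\<close>.\<close>
  with h(1) have "eventually (\<lambda>\<alpha>. \<exists>s. range s \<subseteq> B \<alpha> \<inter> L \<and> J s = h \<alpha>) ae"
  proof eventually_elim
    case (elim \<alpha>)
    have "B \<alpha> \<inter> elts (lam (Suc n)) \<lesssim> B \<alpha> \<inter> L" for n
      by (rule subset_imp_lepoll) (auto simp: L_def)
    then have "Pow (elts (lam n)) \<lesssim> B \<alpha> \<inter> L" for n using elim(2) lepoll_trans by blast
    moreover have "h \<alpha> \<in> L" using elim(1) by (auto simp: L_def)
    ultimately show ?case by (intro J) auto
  qed
  from eventually_ae_choice[OF this] obtain s
    where s: "eventually (\<lambda>\<alpha>. range (s \<alpha>) \<subseteq> B \<alpha> \<inter> L \<and> J (s \<alpha>) = h \<alpha>) ae" by blast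
  \<comment> \<open>Each entry is a selection from \<open>B\<close>, hence constant; by
    sigma-completeness so is the whole sequence, which makes \<open>h\<close> constant.\<close>
  have "\<exists>\<xi>. eventually (\<lambda>\<alpha>. s \<alpha> n = \<xi>) ae" for n
  proof -
    have "eventually (\<lambda>\<alpha>. s \<alpha> n \<in> B \<alpha>) ae" using s by eventually_elim blast
    from selection_B[OF this] show ?thesis by blast
  qed
  then obtain t where "\<And>n. eventually (\<lambda>\<alpha>. s \<alpha> n = t n) ae" by metis
  then have "eventually (\<lambda>\<alpha>. \<forall>n. s \<alpha> n = t n) ae" by (rule eventually_ae_all_nat)
  with s have "eventually (\<lambda>\<alpha>. h \<alpha> = J t) ae"
  proof eventually_elim
    case (elim \<alpha>)
    then have "s \<alpha> = t" by blast
    then show ?case using elim by simp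
  qed
  then show False using h(2) by blast
qed

text \<open>If some nonconstant function is bounded by an element of \<open>D\<close>, the failure
  of the claim yields a sequence contradicting \<open>kunen\<close>. Otherwise \<open>h\<close>
  eventually exceeds each element of \<open>D\<close>, so \<open>B \<alpha> \<inter> D\<close> is
  contained in \<open>h \<alpha>\<close>, which is small relative to \<open>D\<close>.\<close>

lemma eventually_B_Int_lesspoll:
  assumes D: "strong_limit D" and h: "eventually (\<lambda>\<alpha>. h \<alpha> \<in> D) ae" "nonconstant h"
  shows "eventually (\<lambda>\<alpha>. B \<alpha> \<inter> D \<prec> D) ae"
proof (cases "\<exists>\<nu>\<in>D. \<exists>h. eventually (\<lambda>\<alpha>. h \<alpha> \<in> elts \<nu>) ae \<and> nonconstant h")
  case True
  then obtain \<nu> h where \<nu>: "\<nu> \<in> D" and h: "eventually (\<lambda>\<alpha>. h \<alpha> \<in> elts \<nu>) ae" "nonconstant h"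
    by blast
  show ?thesis
  proof (rule ccontr)
    assume "\<not> ?thesis"
    then have large: "eventually (\<lambda>\<alpha>. D \<lesssim> B \<alpha> \<inter> D) ae"
      unfolding eventually_ae_not[symmetric] not_lepoll_iff_lesspoll[symmetric] by simp
    have step: "\<exists>\<eta>. \<eta> \<in> D \<and> eventually (\<lambda>\<alpha>. Pow (elts \<mu>) \<lesssim> B \<alpha> \<inter> elts \<eta>) ae" if "\<mu> \<in> D" for \<mu>
    proof -
      \<comment> \<open>The end point \<open>a\<close> of a long enough initial segment of
        \<open>B \<alpha> \<inter> D\<close> is taken in \<open>B \<alpha>\<close>, so its choice is
        constant almost everywhere.\<close>
      have "eventually (\<lambda>\<alpha>. \<exists>a. a \<in> B \<alpha> \<inter> D \<and> Pow (elts \<mu>) \<lesssim> B \<alpha> \<inter> elts a) ae"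
        using large
      proof eventually_elim
        case (elim \<alpha>)
        then have "Pow (elts \<mu>) \<prec> B \<alpha> \<inter> D"
          using D that unfolding strong_limit_def using lesspoll_trans2 by blast
        then have "\<exists>a\<in>B \<alpha> \<inter> D. Pow (elts \<mu>) \<approx> (B \<alpha> \<inter> D) \<inter> elts a"
          by (rule lesspoll_initial_segment[rotated])
            (use D ordinal_below in \<open>auto simp: strong_limit_def\<close>)
        then obtain a where a: "a \<in> B \<alpha> \<inter> D" "Pow (elts \<mu>) \<approx> (B \<alpha> \<inter> D) \<inter> elts a" by blast
        have "(B \<alpha> \<inter> D) \<inter> elts a \<lesssim> B \<alpha> \<inter> elts a" by (rule subset_imp_lepoll) blast
        then have "Pow (elts \<mu>) \<lesssim> B \<alpha> \<inter> elts a" using a(2) lepoll_trans1 by blast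
        then show ?case using a(1) by blast
      qed
      from eventually_ae_choice[OF this] obtain g
        where g: "eventually (\<lambda>\<alpha>. g \<alpha> \<in> B \<alpha> \<inter> D \<and> Pow (elts \<mu>) \<lesssim> B \<alpha> \<inter> elts (g \<alpha>)) ae" by blast
      then have "eventually (\<lambda>\<alpha>. g \<alpha> \<in> B \<alpha>) ae" by eventually_elim blast
      from selection_B[OF this] obtain \<eta> where "eventually (\<lambda>\<alpha>. g \<alpha> = \<eta>) ae" by blast
      with g have "eventually (\<lambda>\<alpha>. \<eta> \<in> D \<and> Pow (elts \<mu>) \<lesssim> B \<alpha> \<inter> elts \<eta>) ae"
        by eventually_elim auto
      then show ?thesis by (auto simp: eventually_conj_iff)
    qed
    \<comment> \<open>The sequence starts at \<open>\<nu>\<close>, so that the nonconstant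
      \<open>h\<close> lies below \<open>lam 0\<close>.\<close>
    have "\<exists>lam. \<forall>n. (lam n \<in> D \<and> (n = 0 \<longrightarrow> lam n = \<nu>)) \<and>
        eventually (\<lambda>\<alpha>. Pow (elts (lam n)) \<lesssim> B \<alpha> \<inter> elts (lam (Suc n))) ae"
      by (rule dependent_nat_choice) (use \<nu> step in auto)
    then obtain lam where "\<And>n. lam n \<in> D" "lam 0 = \<nu>"
      "\<And>n. eventually (\<lambda>\<alpha>. Pow (elts (lam n)) \<lesssim> B \<alpha> \<inter> elts (lam (Suc n))) ae"
      by blast
    then show False using kunen[of lam h] h D unfolding strong_limit_def by blast
  qed
next
  case False
  have above: "eventually (\<lambda>\<alpha>. \<xi> \<in> elts (h \<alpha>)) ae" if "\<xi> \<in> D" for \<xi>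
  proof -
    have "\<not> eventually (\<lambda>\<alpha>. h \<alpha> \<in> elts \<xi>) ae" using False that h(2) by blast
    then have "eventually (\<lambda>\<alpha>. h \<alpha> \<notin> elts \<xi>) ae" by (simp add: eventually_ae_not)
    moreover have "eventually (\<lambda>\<alpha>. h \<alpha> \<noteq> \<xi>) ae" using h(2) by (simp add: eventually_ae_not)
    ultimately show ?thesis using h(1)
    proof eventually_elim
      case (elim \<alpha>)
      then have "ordinal (h \<alpha>)" "ordinal \<xi>"
        using that D ordinal_below unfolding strong_limit_def by blast+
      then show ?case using elim ordinal_linear[of "h \<alpha>" \<xi>] by blast
    qed
  qed
  have "eventually (\<lambda>\<alpha>. B \<alpha> \<inter> D \<subseteq> elts (h \<alpha>)) ae"
  proof (rule ccontr)
    assume "\<not> ?thesis"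
    then have "eventually (\<lambda>\<alpha>. \<exists>\<nu>. \<nu> \<in> B \<alpha> \<inter> D \<and> \<nu> \<notin> elts (h \<alpha>)) ae"
      unfolding eventually_ae_not[symmetric] by eventually_elim auto
    from eventually_ae_choice[OF this] obtain g
      where g: "eventually (\<lambda>\<alpha>. g \<alpha> \<in> B \<alpha> \<inter> D \<and> g \<alpha> \<notin> elts (h \<alpha>)) ae" by blast
    then have "eventually (\<lambda>\<alpha>. g \<alpha> \<in> B \<alpha>) ae" by eventually_elim blast
    from selection_B[OF this] obtain \<xi> where "eventually (\<lambda>\<alpha>. g \<alpha> = \<xi>) ae" by blast
    with g have "eventually (\<lambda>\<alpha>. \<xi> \<in> D \<and> \<xi> \<notin> elts (h \<alpha>)) ae" by eventually_elim auto
    then have "\<xi> \<in> D" "\<not> eventually (\<lambda>\<alpha>. \<xi> \<in> elts (h \<alpha>)) ae"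
      by (simp_all add: eventually_conj_iff eventually_ae_not)
    then show False using above by blast
  qed
  with h(1) show ?thesis
  proof eventually_elim
    case (elim \<alpha>)
    have "B \<alpha> \<inter> D \<lesssim> Pow (elts (h \<alpha>))"
      using elim(2) lepoll_trans[OF subset_imp_lepoll lepoll_Pow_self] by blast
    moreover have "Pow (elts (h \<alpha>)) \<prec> D" using elim(1) D unfolding strong_limit_def by blast
    ultimately show ?case by (rule lesspoll_trans1)
  qed
qed

text \<open>The witness is the critical point of the ultrapower embedding.\<close>

lemma nonconstant_into_strong_limit:
  "\<exists>D h. strong_limit D \<and> eventually (\<lambda>\<alpha>. h \<alpha> \<in> D) ae \<and> nonconstant h"
proof -
  define P where "P = (\<lambda>\<delta>. (\<delta> = \<kappa> \<or> \<delta> \<in> elts \<kappa>) \<and>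
    (\<exists>h. eventually (\<lambda>\<alpha>. h \<alpha> \<in> elts \<delta>) ae \<and> nonconstant h))"
  have "nonconstant (\<lambda>\<alpha>. \<alpha>)"
  proof (intro allI notI)
    fix c assume c: "eventually (\<lambda>\<alpha>. \<alpha> = c) ae"
    with eventually_ae_in have "eventually (\<lambda>\<alpha>. c \<in> elts \<kappa>) ae" by eventually_elim simp
    then have "c \<in> elts \<kappa>" by simp
    from eventually_mem_index[OF this] c have "eventually (\<lambda>_. False) ae"
      by eventually_elim (simp add: mem_irrefl)
    then show False by simp
  qed
  then have "P \<kappa>" unfolding P_def using eventually_ae_in by (intro conjI disjI1 exI[of _ "\<lambda>\<alpha>. \<alpha>"]) auto
  then obtain \<delta> where \<delta>: "P \<delta>" "\<forall>x\<in>elts \<delta>. \<not> P x" using mem_min[of P] by blast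
  then obtain h where h: "eventually (\<lambda>\<alpha>. h \<alpha> \<in> elts \<delta>) ae" "nonconstant h" by (auto simp: P_def)
  have \<delta>\<kappa>: "elts \<delta> \<subseteq> elts \<kappa>" and ord: "ordinal \<delta>"
    using \<delta>(1) ordinal_trans[OF ordinal_\<kappa>] ordinal_\<kappa> ordinal_below by (auto simp: P_def)
  have "Pow (elts x) \<prec> elts \<delta>" if x: "x \<in> elts \<delta>" for x
  proof (rule ccontr)
    assume "\<not> ?thesis"
    then obtain e where e: "inj_on e (elts \<delta>)" "e ` elts \<delta> \<subseteq> Pow (elts x)"
      using lesspoll_cases[of "Pow (elts x)" "elts \<delta>"] by (auto simp: lepoll_def)
    \<comment> \<open>The only candidate for a constant value of \<open>e (h \<alpha>)\<close>; it
      is attained because functions into \<open>x\<close> are constant by minimality of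
      \<open>\<delta>\<close>.\<close>
    define Y where "Y = {\<xi> \<in> elts x. eventually (\<lambda>\<alpha>. \<xi> \<in> e (h \<alpha>)) ae}"
    have "eventually (\<lambda>\<alpha>. e (h \<alpha>) = Y) ae"
    proof (rule ccontr)
      assume "\<not> ?thesis"
      then have "eventually (\<lambda>\<alpha>. e (h \<alpha>) \<noteq> Y) ae" by (simp add: eventually_ae_not)
      with h(1) have "eventually (\<lambda>\<alpha>. \<exists>\<xi>. \<xi> \<in> elts x \<and> (\<xi> \<in> e (h \<alpha>) \<longleftrightarrow> \<xi> \<notin> Y)) ae"
      proof eventually_elim
        case (elim \<alpha>)
        then have "e (h \<alpha>) \<subseteq> elts x" "Y \<subseteq> elts x" using e(2) by (auto simp: Y_def)
        then show ?case using elim(2) by blast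
      qed
      from eventually_ae_choice[OF this] obtain g
        where g: "eventually (\<lambda>\<alpha>. g \<alpha> \<in> elts x \<and> (g \<alpha> \<in> e (h \<alpha>) \<longleftrightarrow> g \<alpha> \<notin> Y)) ae" by blast
      then have "eventually (\<lambda>\<alpha>. g \<alpha> \<in> elts x) ae" by eventually_elim blast
      then obtain c where "eventually (\<lambda>\<alpha>. g \<alpha> = c) ae"
        using \<delta>(2) x \<delta>\<kappa> unfolding P_def by blast
      with g have "eventually (\<lambda>\<alpha>. c \<in> elts x \<and> (c \<in> e (h \<alpha>) \<longleftrightarrow> c \<notin> Y)) ae"
        by eventually_elim auto
      then have "c \<in> elts x" "eventually (\<lambda>\<alpha>. c \<in> e (h \<alpha>) \<longleftrightarrow> c \<notin> Y) ae"
        by (simp_all add: eventually_conj_iff)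
      then show False by (cases "c \<in> Y") (auto simp: Y_def eventually_ae_not)
    qed
    with h(1) have "eventually (\<lambda>\<alpha>. h \<alpha> = inv_into (elts \<delta>) e Y) ae"
      by eventually_elim (use e(1) in auto)
    then show False using h(2) by blast
  qed
  then have "strong_limit (elts \<delta>)"
    using \<delta>\<kappa> ordinal_trans[OF ord] unfolding strong_limit_def by blast
  then show ?thesis using h by blast
qed

text \<open>If \<kappa> is a strong limit, \<open>\<theta>\<close> comes from the bound of
  \<open>B \<alpha>\<close> by \<open>f \<alpha>\<close>; otherwise \<open>\<theta>\<close> is
  constantly the largest strong limit below \<kappa>.\<close>

lemma eventually_Pow_B_lesspoll:
  "\<exists>\<theta> \<in> elts \<kappa> \<rightarrow> elts \<kappa>. eventually (\<lambda>\<alpha>. Pow (B \<alpha>) \<prec> elts (\<theta> (f \<alpha>))) ae"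
proof (cases "strong_limit (elts \<kappa>)")
  case True
  have "\<exists>b\<in>elts \<kappa>. Pow (elts x) \<prec> elts b" if "x \<in> elts \<kappa>" for x
  proof -
    have "Pow (elts x) \<prec> elts \<kappa>" using True that by (simp add: strong_limit_def)
    \<comment> \<open>The second power set makes the bound strict.\<close>
    then have "Pow (Pow (elts x)) \<prec> elts \<kappa>" by (rule strong_limit_Pow[OF True])
    then obtain b where b: "b \<in> elts \<kappa>" "Pow (Pow (elts x)) \<approx> elts b"
      using strong_limit_lesspoll[OF True] by blast
    then show ?thesis using lesspoll_Pow_self lesspoll_eq_trans by blast
  qed
  then obtain \<theta> where \<theta>: "\<forall>x\<in>elts \<kappa>. \<theta> x \<in> elts \<kappa> \<and> Pow (elts x) \<prec> elts (\<theta> x)" by metis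
  have "eventually (\<lambda>\<alpha>. Pow (B \<alpha>) \<prec> elts (\<theta> (f \<alpha>))) ae"
    using eventually_B_subset_f eventually_ae_in
  proof eventually_elim
    case (elim \<alpha>)
    then have "Pow (B \<alpha>) \<lesssim> Pow (elts (f \<alpha>))" by (intro Pow_lepoll_mono subset_imp_lepoll)
    then show ?case using \<theta> elim(2) f_funcset lesspoll_trans1 by blast
  qed
  then show ?thesis using \<theta> by blast
next
  case False
  define D where "D = \<Union> {E. strong_limit E}"
  have D\<kappa>: "D \<subseteq> elts \<kappa>" unfolding D_def strong_limit_def by blast
  have "Pow (elts x) \<prec> D" if "x \<in> E" "strong_limit E" for x E
  proof -
    have "E \<lesssim> D" using that(2) by (intro subset_imp_lepoll) (auto simp: D_def)
    then show ?thesis using that lesspoll_trans2 unfolding strong_limit_def by blast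
  qed
  moreover have "elts x \<subseteq> D" if "x \<in> E" "strong_limit E" for x E
    using that unfolding D_def strong_limit_def by blast
  ultimately have D: "strong_limit D"
    using D\<kappa> unfolding strong_limit_def[of D] unfolding D_def by blast
  then have "D \<noteq> elts \<kappa>" using False by blast
  then obtain z where "z \<in> elts \<kappa> - D" using D\<kappa> by blast
  \<comment> \<open>Since \<open>D\<close> is closed downwards, the least ordinal outside it has
    exactly \<open>D\<close> as its set of elements.\<close>
  then obtain d where d: "d \<in> elts \<kappa> - D" "\<forall>y\<in>elts d. y \<notin> elts \<kappa> - D"
    using mem_min[of "\<lambda>d. d \<in> elts \<kappa> - D" z] by blast
  have "D = elts d"
  proof
    show "elts d \<subseteq> D" using d ordinal_trans[OF ordinal_\<kappa>] by blast
    show "D \<subseteq> elts d"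
    proof
      fix x assume x: "x \<in> D"
      then have "d \<notin> elts x" "x \<noteq> d" using d(1) D unfolding strong_limit_def by blast+
      then show "x \<in> elts d" using ordinal_linear[of x d] x D\<kappa> d(1) ordinal_below by blast
    qed
  qed
  obtain E h where "strong_limit E" and h: "eventually (\<lambda>\<alpha>. h \<alpha> \<in> E) ae" "nonconstant h"
    using nonconstant_into_strong_limit by blast
  then have "eventually (\<lambda>\<alpha>. h \<alpha> \<in> D) ae" by (auto simp: D_def elim: eventually_mono)
  from eventually_B_Int_lesspoll[OF D this h(2)]
  have BD: "eventually (\<lambda>\<alpha>. B \<alpha> \<inter> D \<prec> D) ae" .
  have "eventually (\<lambda>\<alpha>. B \<alpha> \<inter> elts \<kappa> \<prec> D) ae"
  proof (rule ccontr)
    \<comment> \<open>A least failure \<open>\<mu>\<close> is not contained in \<open>D\<close>,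
      hence not a strong limit, so it injects into the power set of a smaller \<open>x\<close>. The
      bound at \<open>x\<close> then carries over to \<open>\<mu>\<close>, as \<open>D\<close> is
      closed under power sets.\<close>
    define P where "P = (\<lambda>\<mu>. (\<mu> = \<kappa> \<or> \<mu> \<in> elts \<kappa>) \<and> \<not> eventually (\<lambda>\<alpha>. B \<alpha> \<inter> elts \<mu> \<prec> D) ae)"
    assume "\<not> ?thesis"
    then have "P \<kappa>" by (simp add: P_def)
    then obtain \<mu> where \<mu>: "P \<mu>" "\<forall>x\<in>elts \<mu>. \<not> P x" using mem_min[of P] by blast
    have \<mu>\<kappa>: "elts \<mu> \<subseteq> elts \<kappa>" and ord: "ordinal \<mu>"
      using \<mu>(1) ordinal_trans[OF ordinal_\<kappa>] ordinal_\<kappa> ordinal_below by (auto simp: P_def)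
    have "\<not> elts \<mu> \<subseteq> D"
    proof
      assume "elts \<mu> \<subseteq> D"
      have "eventually (\<lambda>\<alpha>. B \<alpha> \<inter> elts \<mu> \<prec> D) ae"
        using BD
      proof eventually_elim
        case (elim \<alpha>)
        have "B \<alpha> \<inter> elts \<mu> \<lesssim> B \<alpha> \<inter> D" using \<open>elts \<mu> \<subseteq> D\<close> by (intro subset_imp_lepoll) blast
        then show ?case using elim by (rule lesspoll_trans1)
      qed
      then show False using \<mu>(1) by (simp add: P_def)
    qed
    then have "\<not> strong_limit (elts \<mu>)" by (auto simp: D_def)
    then obtain x where x: "x \<in> elts \<mu>" "\<not> Pow (elts x) \<prec> elts \<mu>"
      using \<mu>\<kappa> ordinal_trans[OF ord] unfolding strong_limit_def by blast
    then have "elts \<mu> \<lesssim> Pow (elts x)" using lesspoll_cases by blast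
    moreover have "elts x \<subseteq> elts \<kappa>" using x(1) \<mu>\<kappa> ordinal_trans[OF ordinal_\<kappa>] by blast
    ultimately have "eventually (\<lambda>\<alpha>. B \<alpha> \<inter> elts \<mu> \<lesssim> Pow (B \<alpha> \<inter> elts x)) ae"
      by (rule eventually_B_lepoll_Pow)
    moreover have "eventually (\<lambda>\<alpha>. B \<alpha> \<inter> elts x \<prec> D) ae"
      using \<mu>(2) x(1) \<mu>\<kappa> unfolding P_def by blast
    ultimately have "eventually (\<lambda>\<alpha>. B \<alpha> \<inter> elts \<mu> \<prec> D) ae"
    proof eventually_elim
      case (elim \<alpha>)
      then show ?case using strong_limit_Pow[OF D elim(2)] lesspoll_trans1 by blast
    qed
    then show False using \<mu>(1) by (simp add: P_def)
  qed
  with eventually_ae_in have "eventually (\<lambda>\<alpha>. Pow (B \<alpha>) \<prec> elts d) ae"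
  proof eventually_elim
    case (elim \<alpha>)
    then have "B \<alpha> \<subseteq> elts \<kappa>" using ordinal_trans[OF ordinal_\<kappa>] by (auto simp: B_def)
    then have "B \<alpha> \<inter> elts \<kappa> = B \<alpha>" by blast
    then show ?case using strong_limit_Pow[OF D, of "B \<alpha>"] elim(2) \<open>D = elts d\<close> by simp
  qed
  then show ?thesis using d(1) by (intro bexI[of _ "\<lambda>_. d"]) auto
qed

section \<open>Counting traces against the Galvin property\<close>

lemma not_galvin: "\<not> galvin_property \<kappa> U"
proof
  assume galvin: "galvin_property \<kappa> U"
  obtain b where b: "bij_betw b (elts (two_to_the \<kappa>)) (Pow (elts \<kappa>))"
    using two_to_the_eqpoll by (auto simp: eqpoll_def)
  define A where "A = (\<lambda>i. {\<alpha> \<in> elts \<kappa>. b i \<inter> elts \<alpha> \<in> \<A> \<alpha>})"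
  have "\<forall>i\<in>elts (two_to_the \<kappa>). A i \<in> U"
  proof
    fix i assume "i \<in> elts (two_to_the \<kappa>)"
    then have "b i \<subseteq> elts \<kappa>" using b by (auto simp: bij_betw_def)
    then show "A i \<in> U" using trace unfolding A_def eventually_ae by blast
  qed
  then obtain I where I: "I \<subseteq> elts (two_to_the \<kappa>)" "I \<approx> elts \<kappa>" "(\<Inter>i\<in>I. A i) \<in> U"
    using galvin unfolding galvin_property_def by blast
  obtain t where t: "bij_betw t (elts \<kappa>) I" using I(2) eqpoll_sym unfolding eqpoll_def by blast
  define X where "X = (\<lambda>\<xi>. b (t \<xi>))"
  have X_sub: "X \<xi> \<subseteq> elts \<kappa>" if "\<xi> \<in> elts \<kappa>" for \<xi>
    using that t I(1) b unfolding X_def bij_betw_def by blast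
  have X_inj: "X \<xi> \<noteq> X \<eta>" if "\<xi> \<in> elts \<kappa>" "\<eta> \<in> elts \<kappa>" "\<xi> \<noteq> \<eta>" for \<xi> \<eta>
  proof -
    have "t \<xi> \<in> I" "t \<eta> \<in> I" "t \<xi> \<noteq> t \<eta>" using that t by (auto simp: bij_betw_def inj_on_def)
    then show ?thesis using b I(1) unfolding X_def bij_betw_def by (meson inj_onD subsetD)
  qed
  have X_trace: "eventually (\<lambda>\<alpha>. \<forall>\<xi>\<in>elts \<kappa>. X \<xi> \<inter> elts \<alpha> \<in> \<A> \<alpha>) ae"
  proof -
    define G where "G = (\<Inter>i\<in>I. A i)"
    have "U \<subseteq> Pow (elts \<kappa>)" using ultrafilter by (simp add: ultrafilter_over_def)
    then have "G \<subseteq> elts \<kappa>" using I(3) unfolding G_def by (meson PowD subsetD)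
    then have "{\<alpha> \<in> elts \<kappa>. \<alpha> \<in> G} = G" by blast
    then have "eventually (\<lambda>\<alpha>. \<alpha> \<in> G) ae" using I(3) by (simp add: eventually_ae G_def)
    then show ?thesis
    proof (eventually_elim, intro ballI)
      fix \<alpha> \<xi> assume "\<alpha> \<in> G" "\<xi> \<in> elts \<kappa>"
      then have "\<alpha> \<in> A (t \<xi>)" using t by (auto simp: G_def bij_betw_def)
      then show "X \<xi> \<inter> elts \<alpha> \<in> \<A> \<alpha>" by (simp add: A_def X_def)
    qed
  qed
  obtain \<theta> where \<theta>: "\<theta> \<in> elts \<kappa> \<rightarrow> elts \<kappa>" "eventually (\<lambda>\<alpha>. Pow (B \<alpha>) \<prec> elts (\<theta> (f \<alpha>))) ae"
    using eventually_Pow_B_lesspoll by blast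
  \<comment> \<open>On the diagonal any element of \<kappa> serves, so that the values at all pairs
    can be bounded together.\<close>
  have "\<forall>\<xi> \<eta>. \<exists>z. \<xi> \<in> elts \<kappa> \<and> \<eta> \<in> elts \<kappa> \<longrightarrow> z \<in> elts \<kappa> \<and> (\<xi> \<noteq> \<eta> \<longrightarrow> (z \<in> X \<xi> \<longleftrightarrow> z \<notin> X \<eta>))"
    using X_inj X_sub by blast
  then obtain \<Delta> where \<Delta>: "\<And>\<xi> \<eta>. \<xi> \<in> elts \<kappa> \<Longrightarrow> \<eta> \<in> elts \<kappa> \<Longrightarrow> \<Delta> \<xi> \<eta> \<in> elts \<kappa>"
    "\<And>\<xi> \<eta>. \<xi> \<in> elts \<kappa> \<Longrightarrow> \<eta> \<in> elts \<kappa> \<Longrightarrow> \<xi> \<noteq> \<eta> \<Longrightarrow> \<Delta> \<xi> \<eta> \<in> X \<xi> \<longleftrightarrow> \<Delta> \<xi> \<eta> \<notin> X \<eta>"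
    by metis
  have "\<exists>\<beta>\<in>elts \<kappa>. \<forall>\<xi>\<in>elts (\<theta> x). \<forall>\<eta>\<in>elts (\<theta> x). \<Delta> \<xi> \<eta> \<in> elts \<beta>" if "x \<in> elts \<kappa>" for x
    using that \<theta>(1) \<Delta>(1) ordinal_trans[OF ordinal_\<kappa>] by (intro bounded_image2) blast+
  then obtain e where e: "\<And>x. x \<in> elts \<kappa> \<Longrightarrow> e x \<in> elts \<kappa>"
    "\<And>x \<xi> \<eta>. x \<in> elts \<kappa> \<Longrightarrow> \<xi> \<in> elts (\<theta> x) \<Longrightarrow> \<eta> \<in> elts (\<theta> x) \<Longrightarrow> \<Delta> \<xi> \<eta> \<in> elts (e x)"
    by metis
  \<comment> \<open>Almost every \<open>\<alpha>\<close> is at least \<open>e (f \<alpha>)\<close>,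
    hence contains the points distinguishing the sets \<open>X \<xi>\<close> for
    \<open>\<xi>\<close> below \<open>\<theta> (f \<alpha>)\<close>. Their traces are then more
    elements of \<open>\<A> \<alpha>\<close> than its bound permits.\<close>
  have "eventually (\<lambda>\<alpha>. \<alpha> \<notin> elts (e (f \<alpha>))) ae" using e(1) by (intro f_fibers) blast
  with X_trace \<theta>(2) eventually_\<A>_lepoll eventually_ae_in have "eventually (\<lambda>_. False) ae"
  proof eventually_elim
    case (elim \<alpha>)
    have f\<alpha>: "f \<alpha> \<in> elts \<kappa>" using elim f_funcset by blast
    then have \<theta>\<kappa>: "elts (\<theta> (f \<alpha>)) \<subseteq> elts \<kappa>" using \<theta>(1) ordinal_trans[OF ordinal_\<kappa>] by blast
    have e\<alpha>: "elts (e (f \<alpha>)) \<subseteq> elts \<alpha>"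
      using elim e(1)[OF f\<alpha>] ordinal_subset_iff ordinal_below by blast
    have "inj_on (\<lambda>\<xi>. X \<xi> \<inter> elts \<alpha>) (elts (\<theta> (f \<alpha>)))"
    proof (rule inj_onI, rule ccontr)
      fix \<xi> \<eta> assume *: "\<xi> \<in> elts (\<theta> (f \<alpha>))" "\<eta> \<in> elts (\<theta> (f \<alpha>))" "\<xi> \<noteq> \<eta>"
        and eq: "X \<xi> \<inter> elts \<alpha> = X \<eta> \<inter> elts \<alpha>"
      have "\<Delta> \<xi> \<eta> \<in> elts \<alpha>" using e(2)[OF f\<alpha> *(1,2)] e\<alpha> by blast
      moreover have "\<Delta> \<xi> \<eta> \<in> X \<xi> \<longleftrightarrow> \<Delta> \<xi> \<eta> \<notin> X \<eta>" using \<Delta>(2) * \<theta>\<kappa> by blast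
      ultimately show False using eq by blast
    qed
    moreover have "(\<lambda>\<xi>. X \<xi> \<inter> elts \<alpha>) ` elts (\<theta> (f \<alpha>)) \<subseteq> \<A> \<alpha>" using elim(1) \<theta>\<kappa> by blast
    ultimately have "elts (\<theta> (f \<alpha>)) \<lesssim> \<A> \<alpha>" unfolding lepoll_def by blast
    then have "elts (\<theta> (f \<alpha>)) \<lesssim> Pow (B \<alpha>)" using elim(3) by (rule lepoll_trans)
    then show False using elim(2) not_lepoll_iff_lesspoll by blast
  qed
  then show False by simp
qed

end

theorem corollary3p11:
  fixes \<kappa> :: "'v::zfc_universe" and U :: "'v set set"
  assumes "regular_cardinal \<kappa>" and "uncountable (elts \<kappa>)"
    and "ultrafilter_over (elts \<kappa>) U" and "sigma_complete U"
    and "dodd_sound \<kappa> U"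
    and "\<not> p_point \<kappa> U"
  shows "\<not> galvin_property \<kappa> U"
proof -
  interpret sigma_ultrafilter \<kappa> U using assms(3,4) by unfold_locales
  have "ordinal \<kappa>" using assms(1) by (simp add: regular_cardinal_def cardinal_def)
  then obtain f where f: "f \<in> elts \<kappa> \<rightarrow> elts \<kappa>"
    "\<And>\<xi>. \<xi> \<in> elts \<kappa> \<Longrightarrow> eventually (\<lambda>\<alpha>. f \<alpha> \<notin> elts \<xi>) ae"
    "\<And>e. e \<in> elts \<kappa> \<rightarrow> elts \<kappa> \<Longrightarrow> eventually (\<lambda>\<alpha>. \<alpha> \<notin> elts (e (f \<alpha>))) ae"
    using not_p_point_fibers[OF assms(6)] by blast
  obtain \<A> :: "'v \<Rightarrow> 'v set set" where
    "\<And>X. X \<subseteq> elts \<kappa> \<Longrightarrow> eventually (\<lambda>\<alpha>. X \<inter> elts \<alpha> \<in> \<A> \<alpha>) ae"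
    "\<And>g. eventually (\<lambda>\<alpha>. g \<alpha> \<in> \<A> \<alpha>) ae \<Longrightarrow>
      \<exists>X \<subseteq> elts \<kappa>. eventually (\<lambda>\<alpha>. g \<alpha> = X \<inter> elts \<alpha>) ae"
    using dodd_sound_family[OF assms(5)] by blast
  then interpret dodd_family \<kappa> U \<A> f using assms(1) f by unfold_locales
  show ?thesis by (rule not_galvin)
qed

end
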